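(* Let $d>2$ be an integer, let $T=(S,B)$ be the $d$-regular tree with a fixed root $s_0\in S$, and let $E$ be a finite set. Let $(\alpha_s)_{s\in S}$ be a process with state space $E$ on a standard probability space $(\Omega,\mathscr A,\mu)$ whose law is invariant under the group $\mathrm{Aut}_0(T)$ of parity preserving automorphisms of $T$. If $(\alpha_s)_{s\in S}$ is $\psi$-mixing with exponential decay rate $\lambda>2\log(d-1)$, then there exists a constant $h\in[0,\log|E|]$ such that $$\lim_{n\to\infty}\frac{I\big(\alpha_{S_{2n}}\big)}{|S_{2n}|}=h$$ in $L^1(\mu)$ and $\mu$-almost surely.
   Context: Tree: $T=(S,B)$ is the $d$-regular tree with vertex set $S$, with its path metric (number of edges of a shortest path) $d(\cdot,\cdot)$. $S_n=\{t\in S: d(s_0,t)=n\}$. The tree is bipartite; $\mathrm{Aut}_0(T)$ is the group of graph automorphisms of $T$ that preserve the 2-coloring of the vertices. Processes: a process with index set $S$ and finite state space $E$ is a family $(\alpha_s)_{s\in S}$ of measurable partitions $\alpha_s=\{\alpha_s^i: i\in E\}$ of $\Omega$; equivalently each $\alpha_s$ is a random variable $\Omega\to E$. Its law is the push-forward $P$ of $\mu$ on $E^S$. An automorphism $\varphi$ acts on $E^S$ by $\varphi(x_s)_{s\in S}=(x_{\varphi^{-1}s})_{s\in S}$; the law is invariant under $\mathrm{Aut}_0(T)$ if $P(\varphi A)=P(A)$ for all Borel $A\subseteq E^S$ and $\varphi\in\mathrm{Aut}_0(T)$. Information function: for a finite set $F\subseteq S$, $\alpha_F=\bigvee_{s\in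 F}\alpha_s$ is the joint partition, with atoms $\alpha_F^{i}=\bigcap_{s\in F}\alpha_s^{i_s}$, $i\in E^F$. For a finite measurable partition $\alpha=\{\alpha^i\}_i$ of $\Omega$, $I(\alpha):=-\sum_i \mathbf 1_{\alpha^i}\log\mu(\alpha^i)$ (a function on $\Omega$, defined $\mu$-a.e.). $\psi$-mixing: for finite nonempty $U,V\subseteq S$ let $$\psi(U,V):=\sup_{i,j}\left|\frac{\mu(\alpha_U^i\cap\alpha_V^j)}{\mu(\alpha_U^i)\,\mu(\alpha_V^j)}-1\right|,$$ the supremum being over $i\in E^U$, $j\in E^V$ with $\mu(\alpha_U^i)\mu(\alpha_V^j)>0$. For $\lambda>0$ the process is $\psi$-mixing with exponential decay rate $\lambda$ if there is $C>0$ such that for all finite nonempty $U,V\subseteq S$ $$\psi(U,V)\le C\,|U|\,|V|\,e^{-\lambda d(U,V)}\quad\text{whenever the right-hand side is}\le 1,$$ where $d(U,V)=\min\{d(s,t):s\in U,t\in V\}$. *)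

theory Defs
  imports "HOL-Probability.Probability"
begin

section \<open>Regular trees\<close>

definition simple_graph :: "'s set \<Rightarrow> 's set set \<Rightarrow> bool" where
  "simple_graph S B \<longleftrightarrow> (\<forall>e\<in>B. \<exists>u\<in>S. \<exists>v\<in>S. u \<noteq> v \<and> e = {u, v})"

definition graph_walk :: "'s set \<Rightarrow> 's set set \<Rightarrow> 's list \<Rightarrow> bool" where
  "graph_walk S B xs \<longleftrightarrow>
     xs \<noteq> [] \<and> set xs \<subseteq> S \<and> (\<forall>k. Suc k < length xs \<longrightarrow> {xs ! k, xs ! Suc k} \<in> B)"

definition graph_connected :: "'s set \<Rightarrow> 's set set \<Rightarrow> bool" where
  "graph_connected S B \<longleftrightarrow>
     (\<forall>s\<in>S. \<forall>t\<in>S. \<exists>xs. graph_walk S B xs \<and> hd xs = s \<and> last xs = t)"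

text \<open>A cycle is listed without repeating its first vertex at the end.\<close>

definition graph_cycle :: "'s set \<Rightarrow> 's set set \<Rightarrow> 's list \<Rightarrow> bool" where
  "graph_cycle S B xs \<longleftrightarrow>
     graph_walk S B xs \<and> distinct xs \<and> 3 \<le> length xs \<and> {last xs, hd xs} \<in> B"

text \<open>The predicate \<open>tree\<close> of the AFP entry Graph Theory is not used: it only excludes
  directed cycles, which is not the right notion for undirected graphs.\<close>

definition is_tree :: "'s set \<Rightarrow> 's set set \<Rightarrow> bool" where
  "is_tree S B \<longleftrightarrow>
     S \<noteq> {} \<and> simple_graph S B \<and> graph_connected S B \<and> (\<nexists>xs. graph_cycle S B xs)"

definition regular_tree :: "nat \<Rightarrow> 's set \<Rightarrow> 's set set \<Rightarrow> bool" where
  "regular_tree d S B \<longleftrightarrow>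
     is_tree S B \<and> (\<forall>s\<in>S. finite {t. {s, t} \<in> B} \<and> card {t. {s, t} \<in> B} = d)"

text \<open>The number of edges of a walk is one less than the number of listed vertices.\<close>

definition graph_dist :: "'s set \<Rightarrow> 's set set \<Rightarrow> 's \<Rightarrow> 's \<Rightarrow> nat" where
  "graph_dist S B s t =
     (LEAST n. \<exists>xs. graph_walk S B xs \<and> hd xs = s \<and> last xs = t \<and> length xs = Suc n)"

definition graph_sphere :: "'s set \<Rightarrow> 's set set \<Rightarrow> 's \<Rightarrow> nat \<Rightarrow> 's set" where
  "graph_sphere S B s0 n = {t\<in>S. graph_dist S B s0 t = n}"

text \<open>Distance of two finite nonempty vertex sets.\<close>

definition graph_setdist :: "'s set \<Rightarrow> 's set set \<Rightarrow> 's set \<Rightarrow> 's set \<Rightarrow> nat" where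
  "graph_setdist S B U V = Min {graph_dist S B s t | s t. s \<in> U \<and> t \<in> V}"


section \<open>Parity preserving automorphisms\<close>

text \<open>Only the values of an automorphism on \<open>S\<close> matter.\<close>

definition graph_aut :: "'s set \<Rightarrow> 's set set \<Rightarrow> ('s \<Rightarrow> 's) \<Rightarrow> bool" where
  "graph_aut S B \<phi> \<longleftrightarrow>
     bij_betw \<phi> S S \<and> (\<forall>s\<in>S. \<forall>t\<in>S. {\<phi> s, \<phi> t} \<in> B \<longleftrightarrow> {s, t} \<in> B)"

definition two_coloring :: "'s set \<Rightarrow> 's set set \<Rightarrow> ('s \<Rightarrow> bool) \<Rightarrow> bool" where
  "two_coloring S B c \<longleftrightarrow> (\<forall>s\<in>S. \<forall>t\<in>S. {s, t} \<in> B \<longrightarrow> c s \<noteq> c t)"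

text \<open>On a tree the 2-coloring is unique up to exchanging the colors, so it does not matter
  which one is preserved.\<close>

definition Aut0 :: "'s set \<Rightarrow> 's set set \<Rightarrow> ('s \<Rightarrow> 's) set" where
  "Aut0 S B =
     {\<phi>. graph_aut S B \<phi> \<and> (\<exists>c. two_coloring S B c \<and> (\<forall>s\<in>S. c (\<phi> s) = c s))}"


section \<open>Standard probability spaces\<close>

definition isomorphic_mod0 :: "'a measure \<Rightarrow> 'b measure \<Rightarrow> bool" where
  "isomorphic_mod0 M N \<longleftrightarrow>
     (\<exists>A\<in>null_sets M. \<exists>B\<in>null_sets N. \<exists>f g.
        let M' = restrict_space M (space M - A); N' = restrict_space N (space N - B) in
        f \<in> measurable M' N' \<and> g \<in> measurable N' M' \<and>
        (\<forall>x\<in>space M'. g (f x) = x) \<and> (\<forall>y\<in>space N'. f (g y) = y) \<and>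
        distr M' N' f = N')"

text \<open>Lebesgue--Rokhlin spaces. Taking completions on both sides includes the
  convention in which the space is complete as well as the one in which it is a standard Borel
  space with a Borel probability measure. The Borel isomorphism theorem allows to use the
  real line as the only model.\<close>

definition standard_prob_space :: "'w measure \<Rightarrow> bool" where
  "standard_prob_space M \<longleftrightarrow>
     prob_space M \<and>
     (\<exists>N :: real measure. prob_space N \<and> sets N = sets borel \<and>
        isomorphic_mod0 (completion M) (completion N))"


section \<open>Processes indexed by vertices\<close>

text \<open>The partition \<open>\<alpha>\<^sub>s\<close> is represented by the random variable that is equal
  to \<open>i\<close> on its atom with index \<open>i\<close>.\<close>

definition process :: "'w measure \<Rightarrow> 'e set \<Rightarrow> 's set \<Rightarrow> ('s \<Rightarrow> 'w \<Rightarrow> 'e) \<Rightarrow> bool" where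
  "process M E S \<alpha> \<longleftrightarrow> (\<forall>s\<in>S. \<alpha> s \<in> measurable M (count_space E))"

text \<open>For finite \<open>E\<close> and countable \<open>S\<close> the product \<open>\<sigma>\<close>-algebra is the Borel
  \<open>\<sigma>\<close>-algebra of the product topology on \<open>E\<^sup>S\<close>.\<close>

definition process_law ::
    "'w measure \<Rightarrow> 'e set \<Rightarrow> 's set \<Rightarrow> ('s \<Rightarrow> 'w \<Rightarrow> 'e) \<Rightarrow> ('s \<Rightarrow> 'e) measure" where
  "process_law M E S \<alpha> =
     distr M (PiM S (\<lambda>_. count_space E)) (\<lambda>\<omega>. \<lambda>s\<in>S. \<alpha> s \<omega>)"

definition shift_action :: "'s set \<Rightarrow> ('s \<Rightarrow> 's) \<Rightarrow> ('s \<Rightarrow> 'e) \<Rightarrow> 's \<Rightarrow> 'e" where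
  "shift_action S \<phi> x = (\<lambda>s\<in>S. x (the_inv_into S \<phi> s))"

definition invariant_law ::
    "'s set \<Rightarrow> ('s \<Rightarrow> 's) set \<Rightarrow> ('s \<Rightarrow> 'e) measure \<Rightarrow> bool" where
  "invariant_law S G P \<longleftrightarrow>
     (\<forall>\<phi>\<in>G. \<forall>A\<in>sets P. measure P (shift_action S \<phi> ` A) = measure P A)"

text \<open>The atom of \<open>\<alpha>\<^sub>F\<close> with index \<open>i \<in> E\<^sup>F\<close>.\<close>

definition joint_atom ::
    "'w measure \<Rightarrow> ('s \<Rightarrow> 'w \<Rightarrow> 'e) \<Rightarrow> 's set \<Rightarrow> ('s \<Rightarrow> 'e) \<Rightarrow> 'w set" where
  "joint_atom M \<alpha> F i = {\<omega>\<in>space M. \<forall>s\<in>F. \<alpha> s \<omega> = i s}"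

text \<open>Information function of the finite partition \<open>{a i | i \<in> J}\<close>. Since \<open>ln 0\<close> is a
  real number, it is defined everywhere; null atoms only affect a null set.\<close>

definition information_fun :: "'w measure \<Rightarrow> 'i set \<Rightarrow> ('i \<Rightarrow> 'w set) \<Rightarrow> 'w \<Rightarrow> real" where
  "information_fun M J a \<omega> = - (\<Sum>i\<in>J. indicator (a i) \<omega> * ln (measure M (a i)))"

definition process_information ::
    "'w measure \<Rightarrow> 'e set \<Rightarrow> ('s \<Rightarrow> 'w \<Rightarrow> 'e) \<Rightarrow> 's set \<Rightarrow> 'w \<Rightarrow> real" where
  "process_information M E \<alpha> F = information_fun M (F \<rightarrow>\<^sub>E E) (joint_atom M \<alpha> F)"


section \<open>Psi-mixing\<close>

text \<open>For a probability measure, finite \<open>E\<close> and finite \<open>U\<close>, \<open>V\<close> the supremum is taken over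
  a finite nonempty set.\<close>

definition psi_coeff ::
    "'w measure \<Rightarrow> 'e set \<Rightarrow> ('s \<Rightarrow> 'w \<Rightarrow> 'e) \<Rightarrow> 's set \<Rightarrow> 's set \<Rightarrow> real" where
  "psi_coeff M E \<alpha> U V =
     Sup {\<bar>measure M (joint_atom M \<alpha> U i \<inter> joint_atom M \<alpha> V j) /
           (measure M (joint_atom M \<alpha> U i) * measure M (joint_atom M \<alpha> V j)) - 1\<bar> | i j.
          i \<in> U \<rightarrow>\<^sub>E E \<and> j \<in> V \<rightarrow>\<^sub>E E \<and>
          measure M (joint_atom M \<alpha> U i) * measure M (joint_atom M \<alpha> V j) > 0}"

definition psi_mixing ::
    "'w measure \<Rightarrow> 'e set \<Rightarrow> 's set \<Rightarrow> 's set set \<Rightarrow> ('s \<Rightarrow> 'w \<Rightarrow> 'e) \<Rightarrow> real \<Rightarrow> bool" where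
  "psi_mixing M E S B \<alpha> lam \<longleftrightarrow>
     lam > 0 \<and>
     (\<exists>C>0. \<forall>U V. finite U \<and> U \<noteq> {} \<and> U \<subseteq> S \<and> finite V \<and> V \<noteq> {} \<and> V \<subseteq> S \<longrightarrow>
        (let b = C * real (card U) * real (card V) *
                 exp (- (lam * real (graph_setdist S B U V)))
         in b \<le> 1 \<longrightarrow> psi_coeff M E \<alpha> U V \<le> b))"


section \<open>Convergence in the mean\<close>

definition converges_L1 ::
    "'w measure \<Rightarrow> (nat \<Rightarrow> 'w \<Rightarrow> real) \<Rightarrow> ('w \<Rightarrow> real) \<Rightarrow> bool" where
  "converges_L1 M f g \<longleftrightarrow>
     (\<forall>n. integrable M (f n)) \<and> integrable M g \<and>
     (\<lambda>n. \<integral>\<omega>. \<bar>f n \<omega> - g \<omega>\<bar> \<partial>M) \<longlonglongrightarrow> 0"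

end

theory Submission
  imports Defs
begin

text \<open>Put \<open>q = d - 1\<close> and let \<open>D(p, x, m)\<close> be the set of the \<open>q\<^sup>m\<close> descendants of \<open>x\<close> at depth
  \<open>m\<close>, seen from its neighbour \<open>p\<close>. Descendants of different children of \<open>x\<close> have distance
  \<open>2m + 2\<close>, so \<open>\<psi>\<close>-mixing makes the information of \<open>D(p, x, m + 1)\<close> the sum of the
  informations of the sets \<open>D(x, y, m)\<close> over the children \<open>y\<close>, up to an error bounded by a
  constant. The same mixing bound controls the covariances of the summands, so the variance of
  \<open>J = I(D(p, x, m)) / q\<^sup>m\<close> contracts geometrically in \<open>m\<close>; this gives convergence to the mean in
  \<open>L\<^sup>1\<close> and, the variances being summable, almost surely. By invariance the mean depends only on \<open>m\<close>
  and on the color of \<open>x\<close>, so passing to grandchildren shows that the means along even or odd \<open>m\<close>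
  form a Cauchy sequence. Finally \<open>S\<^bsub>2n\<^esub>\<close> is the union of the sets \<open>D(s\<^sub>0, y, 2n - 1)\<close> over the
  neighbours \<open>y\<close> of \<open>s\<^sub>0\<close>, which all have the same color.\<close>

section \<open>Non-backtracking walks\<close>

text \<open>Directed edges make the argument self-similar: a branch splits into branches one level
  shorter, so the estimates can be inductions on the depth that treat all directed edges at once.
  The decay rate enters as e^(-lam) \<le> q^(-2): sibling sets have at most d q^m vertices and
  distance 2m + 2, so the mixing bound is at most C d q^(-2m), recorded as \<open>eps m\<close> with
  1/4 in place of q^(-2). It is usable only once it is small. The recursions therefore start at some
  depth m0, where a crude second moment bound, the same for all edges, supplies a finite variance to
  begin with.

  The obstacle is parity: the law is invariant only under maps that keep colors, so the mean may
  depend on the color of the base vertex, and means are compared two levels apart. This is why the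
  radii are even. Invariance is exploited through explicit automorphisms: coordinates by words,
  relative to a directed edge, identify the tree seen from one edge with the tree seen from
  another.\<close>

locale tree_graph =
  fixes S :: "'s set" and B :: "'s set set"
  assumes is_tree: "is_tree S B"
begin

definition nbrs :: "'s \<Rightarrow> 's set" where
  "nbrs s = {t. {s, t} \<in> B}"

definition nb_walk :: "'s list \<Rightarrow> bool" where
  "nb_walk xs \<longleftrightarrow> graph_walk S B xs \<and>
     (\<forall>k. Suc (Suc k) < length xs \<longrightarrow> xs ! k \<noteq> xs ! Suc (Suc k))"

lemma edgeD: "{u, v} \<in> B \<Longrightarrow> u \<in> S \<and> v \<in> S \<and> u \<noteq> v"
  using is_tree unfolding is_tree_def simple_graph_def
  by (metis doubleton_eq_iff insert_absorb2)

lemma nbrs_iff: "t \<in> nbrs s \<longleftrightarrow> {s, t} \<in> B"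
  by (simp add: nbrs_def)

lemma nbrs_subset: "nbrs s \<subseteq> S"
  using edgeD by (auto simp: nbrs_def)

lemma nb_walk_singleton: "x \<in> S \<Longrightarrow> nb_walk [x]"
  by (simp add: nb_walk_def graph_walk_def)

lemma nb_walk_edge: "nb_walk [x, y] \<longleftrightarrow> {x, y} \<in> B"
  using edgeD by (auto simp: nb_walk_def graph_walk_def)

lemma nb_walk_Cons_iff:
  "nb_walk (x # y # zs) \<longleftrightarrow> {x, y} \<in> B \<and> nb_walk (y # zs) \<and> (zs \<noteq> [] \<longrightarrow> x \<noteq> hd zs)"
proof (intro iffI conjI impI)
  assume L: "nb_walk (x # y # zs)"
  then have W: "\<And>k. Suc k < length (x # y # zs) \<Longrightarrow> {(x # y # zs) ! k, (x # y # zs) ! Suc k} \<in> B"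
    and N: "\<And>k. Suc (Suc k) < length (x # y # zs) \<Longrightarrow> (x # y # zs) ! k \<noteq> (x # y # zs) ! Suc (Suc k)"
    and U: "set (x # y # zs) \<subseteq> S"
    by (auto simp: nb_walk_def graph_walk_def)
  show "{x, y} \<in> B" using W[of 0] by simp
  show "nb_walk (y # zs)"
    using W[of "Suc _"] N[of "Suc _"] U by (simp add: nb_walk_def graph_walk_def)
  show "x \<noteq> hd zs" if "zs \<noteq> []" using N[of 0] that by (simp add: hd_conv_nth)
next
  assume R: "{x, y} \<in> B \<and> nb_walk (y # zs) \<and> (zs \<noteq> [] \<longrightarrow> x \<noteq> hd zs)"
  have "{(x # y # zs) ! k, (x # y # zs) ! Suc k} \<in> B" if "Suc k < length (x # y # zs)" for k
    using R that by (cases k) (auto simp: nb_walk_def graph_walk_def)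
  moreover have "(x # y # zs) ! k \<noteq> (x # y # zs) ! Suc (Suc k)"
    if "Suc (Suc k) < length (x # y # zs)" for k
    using R that by (cases k) (auto simp: nb_walk_def hd_conv_nth)
  ultimately show "nb_walk (x # y # zs)"
    using R edgeD[of x y] unfolding nb_walk_def graph_walk_def by auto
qed

lemma nb_walk_tl: "nb_walk (x # xs) \<Longrightarrow> xs \<noteq> [] \<Longrightarrow> nb_walk xs"
  by (cases xs) (auto simp: nb_walk_Cons_iff)

lemma nb_walk_rev: "nb_walk (rev xs) \<longleftrightarrow> nb_walk xs"
proof -
  have "nb_walk (rev xs)" if "nb_walk xs" for xs
  proof -
    have W: "\<And>k. Suc k < length xs \<Longrightarrow> {xs ! k, xs ! Suc k} \<in> B"
      and N: "\<And>k. Suc (Suc k) < length xs \<Longrightarrow> xs ! k \<noteq> xs ! Suc (Suc k)"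
      and U: "set xs \<subseteq> S" "xs \<noteq> []"
      using that by (auto simp: nb_walk_def graph_walk_def)
    have "{rev xs ! k, rev xs ! Suc k} \<in> B" if "Suc k < length xs" for k
      using W[of "length xs - Suc (Suc k)"] that
      by (simp add: rev_nth insert_commute Suc_diff_Suc)
    moreover have "rev xs ! k \<noteq> rev xs ! Suc (Suc k)" if "Suc (Suc k) < length xs" for k
    proof -
      have "Suc (Suc (length xs - Suc (Suc (Suc k)))) = length xs - Suc k" using that by simp
      then show ?thesis
        using N[of "length xs - Suc (Suc (Suc k))", THEN not_sym] that by (simp add: rev_nth)
    qed
    ultimately show ?thesis using U by (simp add: nb_walk_def graph_walk_def)
  qed
  from this[of xs] this[of "rev xs"] show ?thesis by auto
qed

lemma nb_walk_butlast: "nb_walk (xs @ [x]) \<Longrightarrow> xs \<noteq> [] \<Longrightarrow> nb_walk xs"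
  using nb_walk_tl[of x "rev xs"] nb_walk_rev[of "xs @ [x]"] nb_walk_rev[of xs] by simp

lemma nb_walk_append:
  assumes "nb_walk (xs @ [x])" "nb_walk (x # ys)"
    and "xs \<noteq> [] \<Longrightarrow> ys \<noteq> [] \<Longrightarrow> last xs \<noteq> hd ys"
  shows "nb_walk (xs @ x # ys)"
  using assms
proof (induction xs)
  case (Cons a xs)
  show ?case
  proof (cases xs)
    case Nil
    with Cons show ?thesis by (auto simp: nb_walk_Cons_iff)
  next
    case (Cons b zs)
    with Cons.prems have *: "nb_walk (xs @ [x])" "{a, b} \<in> B" "a \<noteq> hd (zs @ [x])"
      by (auto simp: nb_walk_Cons_iff)
    have "nb_walk (xs @ x # ys)"
      using Cons.IH[OF *(1) Cons.prems(2)] Cons.prems(3) Cons by auto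
    moreover have "hd (zs @ x # ys) = hd (zs @ [x])" by (cases zs) auto
    ultimately show ?thesis using * Cons by (simp add: nb_walk_Cons_iff)
  qed
qed simp

lemma nb_walk_snoc:
  assumes "nb_walk xs" "{last xs, v} \<in> B" "length xs \<ge> 2 \<Longrightarrow> last (butlast xs) \<noteq> v"
  shows "nb_walk (xs @ [v])"
proof -
  have "xs \<noteq> []" using assms by (auto simp: nb_walk_def graph_walk_def)
  then obtain ys x where xs: "xs = ys @ [x]" by (metis rev_exhaust)
  have "nb_walk [x, v]" using assms(2) by (simp add: xs nb_walk_edge)
  moreover have "last ys \<noteq> v" if "ys \<noteq> []"
    using assms(3) that by (cases ys) (auto simp: xs)
  ultimately have "nb_walk (ys @ x # [v])"
    using assms(1) nb_walk_append[of ys x "[v]"] unfolding xs by simp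
  then show ?thesis by (simp add: xs)
qed

text \<open>Cutting out a stretch between two consecutive visits of the same vertex would give a cycle.\<close>

lemma nb_walk_distinct:
  assumes "nb_walk xs" shows "distinct xs"
proof (rule ccontr)
  assume nd: "\<not> distinct xs"
  \<comment> \<open>Taking the least gap n over all repetitions, rather than two visits of one
    chosen vertex, makes the entries of the stretch pairwise distinct.\<close>
  define P where "P n \<longleftrightarrow> (\<exists>i. i + n < length xs \<and> n > 0 \<and> xs ! i = xs ! (i + n))" for n
  from nd have "\<exists>n. P n"
    unfolding P_def distinct_conv_nth
    by (metis add_diff_inverse_nat linorder_neqE_nat not_less_iff_gr_or_eq zero_less_diff)
  define n where "n = (LEAST n. P n)"
  have "P n" using \<open>\<exists>n. P n\<close> unfolding n_def by (rule LeastI_ex)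
  then obtain i where i: "i + n < length xs" "n > 0" "xs ! i = xs ! (i + n)"
    unfolding P_def by blast
  have least: "\<not> P m" if "m < n" for m using that not_less_Least unfolding n_def by blast
  have W: "\<And>k. Suc k < length xs \<Longrightarrow> {xs ! k, xs ! Suc k} \<in> B"
      and N: "\<And>k. Suc (Suc k) < length xs \<Longrightarrow> xs ! k \<noteq> xs ! Suc (Suc k)"
      and U: "set xs \<subseteq> S" "xs \<noteq> []"
    using assms by (auto simp: nb_walk_def graph_walk_def)
  \<comment> \<open>A gap of 1 would be an edge from a vertex to itself and a gap of 2 a
    backtracking step; any larger gap is long enough for \<open>graph_cycle\<close>.\<close>
  have "n \<noteq> 1" using W[of i] i edgeD[of "xs ! i" "xs ! Suc i"] by auto
  moreover have "n \<noteq> 2" using N[of i] i by (auto simp: numeral_2_eq_2)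
  ultimately have n3: "n \<ge> 3" using i by simp
  define ys where "ys = take n (drop i xs)"
  have len: "length ys = n" using i by (simp add: ys_def)
  have nth: "ys ! k = xs ! (i + k)" if "k < n" for k
    using that i by (simp add: ys_def)
  have "graph_cycle S B ys"
    unfolding graph_cycle_def graph_walk_def
  proof (intro conjI allI impI)
    show "ys \<noteq> []" using len n3 by auto
    show "set ys \<subseteq> S" using U unfolding ys_def by (meson in_set_dropD in_set_takeD subset_iff)
    show "{ys ! k, ys ! Suc k} \<in> B" if "Suc k < length ys" for k
      using W[of "i + k"] i that len by (simp add: nth)
    show "distinct ys"
      unfolding distinct_conv_nth len
    proof (intro allI impI)
      have *: "ys ! a \<noteq> ys ! b" if "a < b" "b < n" for a b
      proof
        assume "ys ! a = ys ! b"
        then have "P (b - a)"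
          using that i nth[of a] nth[of b] unfolding P_def by (intro exI[of _ "i + a"]) simp
        then show False using least[of "b - a"] that by simp
      qed
      show "ys ! a \<noteq> ys ! b" if "a < n" "b < n" "a \<noteq> b" for a b
        using *[of a b] *[of b a] that by (metis linorder_neqE_nat)
    qed
    show "3 \<le> length ys" using len n3 by simp
    have "last ys = xs ! (i + n - 1)" "hd ys = xs ! (i + n)"
      using nth[of "n - 1"] nth[of 0] n3 len i
      by (auto simp: last_conv_nth hd_conv_nth simp flip: length_greater_0_conv)
    then show "{last ys, hd ys} \<in> B" using W[of "i + n - 1"] i by simp
  qed
  then show False using is_tree by (auto simp: is_tree_def)
qed

section \<open>Non-backtracking walks as the unique geodesics\<close>

lemma nb_walk_closed:
  assumes "nb_walk xs" "hd xs = last xs" shows "length xs = 1"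
proof -
  have "xs \<noteq> []" using assms by (auto simp: nb_walk_def graph_walk_def)
  then have "0 = length xs - 1"
    using nb_walk_distinct[OF assms(1)] assms(2)
    by (simp add: hd_conv_nth last_conv_nth nth_eq_iff_index_eq)
  with \<open>xs \<noteq> []\<close> show ?thesis by (cases xs) auto
qed

text \<open>After reversing the first walk, backtracking could occur only at \<open>x\<close>, and
  the different first steps exclude it. This computes distances between branches and refutes walks
  that would close up.\<close>

lemma nb_walk_join:
  assumes "nb_walk (x # xs)" "nb_walk (x # ys)" "xs \<noteq> [] \<Longrightarrow> ys \<noteq> [] \<Longrightarrow> hd xs \<noteq> hd ys"
  shows "nb_walk (rev xs @ x # ys)"
  using assms nb_walk_rev[of "x # xs"] nb_walk_append[of "rev xs" x ys] by (simp add: last_rev)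

text \<open>Common first steps are peeled off. Where the first steps differ, the reversed tail of
  one walk joined to the other is non-backtracking and returns to its start, which only a single
  vertex can do.\<close>

lemma nb_walk_unique:
  assumes "nb_walk xs" "nb_walk ys" "hd xs = hd ys" "last xs = last ys"
  shows "xs = ys"
  using assms
proof (induction xs arbitrary: ys)
  case Nil
  then show ?case by (simp add: nb_walk_def graph_walk_def)
next
  case (Cons x xs)
  then have "ys \<noteq> []" by (auto simp: nb_walk_def graph_walk_def)
  with Cons obtain zs where ys: "ys = x # zs" by (cases ys) auto
  consider "xs = []" | "zs = []" | "xs \<noteq> []" "zs \<noteq> []" by blast
  then show ?case
  proof cases
    case 1
    with Cons.prems ys nb_walk_closed[of ys] show ?thesis by simp
  next
    case 2
    with Cons.prems ys nb_walk_closed[of "x # xs"] show ?thesis by simp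
  next
    case 3
    show ?thesis
    proof (cases "hd xs = hd zs")
      case True
      with 3 Cons.IH[of zs] Cons.prems ys show ?thesis by (auto dest: nb_walk_tl)
    next
      case False
      then have "nb_walk (rev xs @ x # zs)" using Cons.prems ys by (intro nb_walk_join) auto
      from nb_walk_closed[OF this] 3 Cons.prems ys show ?thesis by (simp add: hd_rev)
    qed
  qed
qed

text \<open>Prepending a step to a reduced walk either keeps it reduced or is undone by its first
  step; in the second case both steps are dropped.\<close>

lemma graph_walk_reduce:
  assumes "graph_walk S B xs"
  shows "\<exists>ys. nb_walk ys \<and> hd ys = hd xs \<and> last ys = last xs \<and> length ys \<le> length xs"
  using assms
proof (induction xs)
  case Nil
  then show ?case by (simp add: graph_walk_def)
next
  case (Cons x xs)
  show ?case
  proof (cases "xs = []")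
    case True
    with Cons.prems show ?thesis
      by (intro exI[of _ "[x]"]) (simp add: nb_walk_singleton graph_walk_def)
  next
    case False
    have "graph_walk S B xs" and e: "{x, hd xs} \<in> B"
      using Cons.prems False unfolding graph_walk_def by (auto simp: hd_conv_nth)
    with Cons.IH obtain ys where ys: "nb_walk ys" "hd ys = hd xs" "last ys = last xs"
        "length ys \<le> length xs" by blast
    then obtain y zs where yz: "ys = y # zs" by (cases ys) (auto simp: nb_walk_def graph_walk_def)
    show ?thesis
    proof (cases "zs \<noteq> [] \<and> hd zs = x")
      case True
      with ys yz False show ?thesis by (intro exI[of _ zs]) (auto dest: nb_walk_tl)
    next
      case *: False
      with ys yz e False show ?thesis
        by (intro exI[of _ "x # ys"]) (auto simp: nb_walk_Cons_iff)
    qed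
  qed
qed

text \<open>Every walk reduces to a non-backtracking one with the same ends that is not longer, and
  by uniqueness the reduced walk is \<open>xs\<close>.\<close>

lemma nb_walk_dist:
  assumes "nb_walk xs" shows "graph_dist S B (hd xs) (last xs) = length xs - 1"
  unfolding graph_dist_def
proof (rule Least_equality)
  have "xs \<noteq> []" "graph_walk S B xs" using assms by (auto simp: nb_walk_def graph_walk_def)
  then show "\<exists>ys. graph_walk S B ys \<and> hd ys = hd xs \<and> last ys = last xs \<and> length ys = Suc (length xs - 1)"
    by (intro exI[of _ xs]) auto
next
  fix n assume "\<exists>ys. graph_walk S B ys \<and> hd ys = hd xs \<and> last ys = last xs \<and> length ys = Suc n"
  then obtain ys where ys: "graph_walk S B ys" "hd ys = hd xs" "last ys = last xs" "length ys = Suc n"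
    by blast
  from graph_walk_reduce[OF ys(1)] obtain zs where
    zs: "nb_walk zs" "hd zs = hd ys" "last zs = last ys" "length zs \<le> length ys" by blast
  have "xs = zs" using ys zs by (intro nb_walk_unique[OF assms]) auto
  then show "length xs - 1 \<le> n" using ys zs by simp
qed

lemma nb_walk_exists:
  assumes "s \<in> S" "t \<in> S" shows "\<exists>xs. nb_walk xs \<and> hd xs = s \<and> last xs = t"
proof -
  obtain ys where "graph_walk S B ys" "hd ys = s" "last ys = t"
    using is_tree assms unfolding is_tree_def graph_connected_def by blast
  with graph_walk_reduce[of ys] show ?thesis by metis
qed

section \<open>Descendants and spheres\<close>

text \<open>The vertices at distance \<open>m\<close> from \<open>x\<close> on the side of the edge \<open>{p, x}\<close> not containing \<open>p\<close>.\<close>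

fun desc :: "'s \<Rightarrow> 's \<Rightarrow> nat \<Rightarrow> 's set" where
  "desc p x 0 = {x}"
| "desc p x (Suc m) = (\<Union>y\<in>nbrs x - {p}. desc x y m)"

text \<open>With \<open>p\<close> kept at the front of the walk, avoiding \<open>p\<close> in the
  first step is part of the non-backtracking condition, so the recursion of \<open>desc\<close>
  matches \<open>nb_walk_Cons_iff\<close>.\<close>

lemma desc_iff:
  assumes "{p, x} \<in> B"
  shows "v \<in> desc p x m \<longleftrightarrow> (\<exists>xs. nb_walk (p # x # xs) \<and> last (x # xs) = v \<and> length xs = m)"
  using assms
proof (induction m arbitrary: p x)
  case 0
  then show ?case by (auto simp: nb_walk_edge)
next
  case (Suc m)
  show ?case
  proof
    assume "v \<in> desc p x (Suc m)"
    then obtain y where y: "{x, y} \<in> B" "y \<noteq> p" "v \<in> desc x y m"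
      unfolding desc.simps nbrs_def by blast
    then obtain xs where "nb_walk (x # y # xs)" "last (y # xs) = v" "length xs = m"
      using Suc.IH by blast
    moreover from this have "nb_walk (p # x # y # xs)"
      using y Suc.prems by (subst nb_walk_Cons_iff) auto
    ultimately show "\<exists>xs. nb_walk (p # x # xs) \<and> last (x # xs) = v \<and> length xs = Suc m"
      by (intro exI[of _ "y # xs"]) simp
  next
    assume "\<exists>xs. nb_walk (p # x # xs) \<and> last (x # xs) = v \<and> length xs = Suc m"
    then obtain y xs where *: "nb_walk (p # x # y # xs)" "last (y # xs) = v" "length xs = m"
      by (auto simp: length_Suc_conv)
    then have "{x, y} \<in> B" "y \<noteq> p" "nb_walk (x # y # xs)"
      by (auto simp: nb_walk_Cons_iff)
    moreover from this have "v \<in> desc x y m" using * Suc.IH[of x y] by blast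
    ultimately show "v \<in> desc p x (Suc m)" unfolding desc.simps nbrs_def by blast
  qed
qed

lemma desc_subset:
  assumes "{p, x} \<in> B" shows "desc p x m \<subseteq> S"
proof
  fix v assume "v \<in> desc p x m"
  then obtain xs where "nb_walk (p # x # xs)" "last (x # xs) = v"
    using desc_iff[OF assms] by blast
  then show "v \<in> S" unfolding nb_walk_def graph_walk_def using last_in_set[of "x # xs"] by auto
qed

text \<open>The branches leave \<open>x\<close> in different directions, so the geodesic from
  \<open>a\<close> to \<open>b\<close> runs through \<open>x\<close> and has (m + 1) + (n + 1)
  edges.\<close>

lemma desc_dist:
  assumes "{x, y} \<in> B" "{x, z} \<in> B" "y \<noteq> z" "a \<in> desc x y m" "b \<in> desc x z n"
  shows "graph_dist S B a b = m + n + 2"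
proof -
  obtain ys where ys: "nb_walk (x # y # ys)" "last (y # ys) = a" "length ys = m"
    using desc_iff assms by blast
  obtain zs where zs: "nb_walk (x # z # zs)" "last (z # zs) = b" "length zs = n"
    using desc_iff assms by blast
  have "nb_walk (rev (y # ys) @ x # z # zs)"
    using ys zs assms by (intro nb_walk_join) auto
  from nb_walk_dist[OF this] ys zs show ?thesis
    by (simp add: hd_append hd_rev split: if_splits)
qed

lemma desc_disjoint:
  assumes "{x, y} \<in> B" "{x, z} \<in> B" "y \<noteq> z"
  shows "desc x y m \<inter> desc x z m = {}"
proof -
  have False if a: "a \<in> desc x y m" "a \<in> desc x z m" for a
  proof -
    have "a \<in> S" using a desc_subset[OF assms(1)] by blast
    from nb_walk_dist[OF nb_walk_singleton[OF this]] desc_dist[OF assms a] show False by simp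
  qed
  then show ?thesis by blast
qed

lemma graph_dist_eq_iff:
  assumes "s \<in> S"
  shows "t \<in> S \<and> graph_dist S B s t = n \<longleftrightarrow>
     (\<exists>xs. nb_walk (s # xs) \<and> last (s # xs) = t \<and> length xs = n)"
proof
  assume *: "t \<in> S \<and> graph_dist S B s t = n"
  then obtain ys where ys: "nb_walk ys" "hd ys = s" "last ys = t" using nb_walk_exists assms by blast
  then obtain xs where "ys = s # xs" by (cases ys) (auto simp: nb_walk_def graph_walk_def)
  with ys(1,3) have xs: "nb_walk (s # xs)" "last (s # xs) = t" by simp_all
  from nb_walk_dist[OF xs(1)] xs(2) * have "length xs = n" by simp
  with xs show "\<exists>xs. nb_walk (s # xs) \<and> last (s # xs) = t \<and> length xs = n" by blast
next
  assume "\<exists>xs. nb_walk (s # xs) \<and> last (s # xs) = t \<and> length xs = n"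
  then obtain xs where xs: "nb_walk (s # xs)" "last (s # xs) = t" "length xs = n" by blast
  then have "t \<in> S" unfolding nb_walk_def graph_walk_def using last_in_set[of "s # xs"] by auto
  moreover have "graph_dist S B s t = n" using nb_walk_dist[OF xs(1)] xs(2,3) by simp
  ultimately show "t \<in> S \<and> graph_dist S B s t = n" ..
qed

lemma sphere_0: "s \<in> S \<Longrightarrow> graph_sphere S B s 0 = {s}"
  unfolding graph_sphere_def using graph_dist_eq_iff[of s _ 0] by (auto simp: nb_walk_singleton)

lemma sphere_Suc:
  assumes "s \<in> S" shows "graph_sphere S B s (Suc n) = (\<Union>y\<in>nbrs s. desc s y n)"
proof -
  have "(\<exists>xs. nb_walk (s # xs) \<and> last (s # xs) = t \<and> length xs = Suc n) \<longleftrightarrow>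
        (\<exists>y\<in>nbrs s. t \<in> desc s y n)" for t
  proof
    assume "\<exists>xs. nb_walk (s # xs) \<and> last (s # xs) = t \<and> length xs = Suc n"
    then obtain y ys where *: "nb_walk (s # y # ys)" "last (y # ys) = t" "length ys = n"
      by (auto simp: length_Suc_conv)
    then have "{s, y} \<in> B" by (simp add: nb_walk_Cons_iff)
    with * show "\<exists>y\<in>nbrs s. t \<in> desc s y n" using desc_iff nbrs_iff by blast
  next
    assume "\<exists>y\<in>nbrs s. t \<in> desc s y n"
    then obtain y where y: "{s, y} \<in> B" "t \<in> desc s y n" by (auto simp: nbrs_iff)
    then obtain ys where "nb_walk (s # y # ys)" "last (y # ys) = t" "length ys = n"
      using desc_iff by blast
    then show "\<exists>xs. nb_walk (s # xs) \<and> last (s # xs) = t \<and> length xs = Suc n"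
      by (intro exI[of _ "y # ys"]) auto
  qed
  then show ?thesis unfolding graph_sphere_def using graph_dist_eq_iff[OF assms, of _ "Suc n"] by auto
qed

text \<open>The parity of the distance from a root is a coloring: along an edge the geodesic from
  the root is either extended or loses its last vertex.\<close>

lemma two_coloring_exists: "\<exists>c. two_coloring S B c"
proof -
  obtain r where r: "r \<in> S" using is_tree by (auto simp: is_tree_def)
  have "even (graph_dist S B r s) \<noteq> even (graph_dist S B r t)" if e: "{s, t} \<in> B" for s t
  proof -
    have "s \<in> S" using edgeD e by blast
    then obtain xs where xs: "nb_walk xs" "hd xs = r" "last xs = s" using nb_walk_exists r by blast
    then have ne: "xs \<noteq> []" by (auto simp: nb_walk_def graph_walk_def)
    note ds = nb_walk_dist[OF xs(1)]
    show ?thesis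
    proof (cases "length xs \<ge> 2 \<and> last (butlast xs) = t")
      case True
      then have bl: "butlast xs \<noteq> []" by (cases xs rule: rev_cases) auto
      then have "nb_walk (butlast xs)"
        using nb_walk_butlast[of "butlast xs" s] xs append_butlast_last_id[OF ne] by simp
      from nb_walk_dist[OF this] True ds xs ne bl show ?thesis
        by (cases xs rule: rev_cases) (auto simp: hd_append)
    next
      case False
      then have "nb_walk (xs @ [t])" using xs e by (intro nb_walk_snoc) auto
      from nb_walk_dist[OF this] ds xs ne show ?thesis by (cases xs) auto
    qed
  qed
  then show ?thesis unfolding two_coloring_def by (intro exI[of _ "\<lambda>t. even (graph_dist S B r t)"]) auto
qed

lemma nb_walk_color:
  assumes "two_coloring S B c" "nb_walk xs"
  shows "c (last xs) = (c (hd xs) \<longleftrightarrow> odd (length xs))"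
  using assms(2)
proof (induction xs)
  case Nil
  then show ?case by (simp add: nb_walk_def graph_walk_def)
next
  case (Cons x xs)
  show ?case
  proof (cases xs)
    case Nil
    then show ?thesis by simp
  next
    case (Cons y ys)
    then have "{x, y} \<in> B" "nb_walk xs" using Cons.prems by (auto simp: nb_walk_Cons_iff)
    moreover from this have "c x \<noteq> c y" using assms(1) edgeD by (auto simp: two_coloring_def)
    ultimately show ?thesis using Cons.IH Cons by auto
  qed
qed

end

section \<open>Regular trees and their automorphisms\<close>

locale regular_tree_graph =
  fixes d :: nat and S :: "'s set" and B :: "'s set set"
  assumes regular: "regular_tree d S B" and d_gt_2: "d > 2"
begin

sublocale tree_graph S B
  using regular by unfold_locales (simp add: regular_tree_def)

definition q :: nat where "q = d - 1"

lemma q_ge_2: "q \<ge> 2" using d_gt_2 by (simp add: q_def)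

section \<open>Sizes of descendant sets and spheres\<close>

lemma finite_nbrs: "s \<in> S \<Longrightarrow> finite (nbrs s)"
  and card_nbrs: "s \<in> S \<Longrightarrow> card (nbrs s) = d"
  using regular by (auto simp: regular_tree_def nbrs_def)

lemma card_nbrs_minus:
  assumes "{p, x} \<in> B" shows "card (nbrs x - {p}) = q"
proof -
  have "p \<in> nbrs x" "x \<in> S" using assms edgeD by (auto simp: nbrs_iff insert_commute)
  then show ?thesis using card_nbrs finite_nbrs by (simp add: q_def)
qed

lemma finite_desc: "{p, x} \<in> B \<Longrightarrow> finite (desc p x m)"
proof (induction m arbitrary: p x)
  case (Suc m)
  then show ?case using finite_nbrs edgeD by (auto simp: nbrs_iff)
qed simp

lemma card_UN_desc:
  assumes "Y \<subseteq> nbrs x" "finite Y" "\<And>y. y \<in> Y \<Longrightarrow> card (desc x y m) = k"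
  shows "card (\<Union>y\<in>Y. desc x y m) = card Y * k"
proof -
  have "card (\<Union>y\<in>Y. desc x y m) = (\<Sum>y\<in>Y. card (desc x y m))"
    using assms desc_disjoint[of x _ _ m]
    by (intro card_UN_disjoint) (auto simp: nbrs_iff subset_iff finite_desc)
  then show ?thesis using assms(3) by simp
qed

lemma card_desc: "{p, x} \<in> B \<Longrightarrow> card (desc p x m) = q ^ m"
proof (induction m arbitrary: p x)
  case (Suc m)
  have "x \<in> S" using edgeD Suc.prems by blast
  then have "card (desc p x (Suc m)) = card (nbrs x - {p}) * q ^ m"
    unfolding desc.simps using Suc.IH finite_nbrs
    by (intro card_UN_desc) (auto simp: nbrs_iff)
  then show ?case using card_nbrs_minus[OF Suc.prems] by simp
qed simp

lemma card_sphere: "s \<in> S \<Longrightarrow> card (graph_sphere S B s (Suc n)) = d * q ^ n"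
  unfolding sphere_Suc using card_UN_desc[of "nbrs s" s n "q ^ n"] finite_nbrs card_nbrs card_desc
  by (auto simp: nbrs_iff)

text \<open>A directed edge \<open>(p, x)\<close> yields coordinates on the tree: the children of every vertex are
  numbered by \<open>{..<q}\<close>, and a pair \<open>(b, w)\<close> of a side of the edge and a word \<open>w\<close> stands for
  the vertex reached from that side along \<open>w\<close>.\<close>

definition child :: "'s \<Rightarrow> 's \<Rightarrow> nat \<Rightarrow> 's" where
  "child p x = (SOME f. bij_betw f {..<q} (nbrs x - {p}))"

lemma child_bij:
  assumes "{p, x} \<in> B" shows "bij_betw (child p x) {..<q} (nbrs x - {p})"
proof -
  have "finite (nbrs x - {p})" using finite_nbrs edgeD assms by blast
  with card_nbrs_minus[OF assms] have "\<exists>f. bij_betw f {..<q} (nbrs x - {p})"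
    by (metis ex_bij_betw_nat_finite atLeast0LessThan)
  then show ?thesis unfolding child_def by (rule someI_ex)
qed

text \<open>Each letter chooses a child relative to the previous vertex of the walk. Starting with
  both ends of the edge gives the first letter such a predecessor and rules out
  backtracking.\<close>

fun word_walk :: "'s \<Rightarrow> 's \<Rightarrow> nat list \<Rightarrow> 's list" where
  "word_walk p x [] = [p, x]"
| "word_walk p x (i # w) = p # word_walk x (child p x i) w"

definition words :: "nat list set" where "words = {w. set w \<subseteq> {..<q}}"

lemma childD:
  assumes "{p, x} \<in> B" "i < q" shows "{x, child p x i} \<in> B" "child p x i \<noteq> p"
  using bij_betwE[OF child_bij[OF assms(1)]] assms(2) by (auto simp: nbrs_iff)

lemma word_walk_Cons: "\<exists>zs. word_walk p x w = p # x # zs \<and> length zs = length w"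
proof (induction w arbitrary: p x)
  case (Cons i w)
  from Cons[of x "child p x i"] show ?case by auto
qed simp

lemma length_word_walk: "length (word_walk p x w) = length w + 2"
  using word_walk_Cons[of p x w] by auto

lemma nb_walk_word_walk: "{p, x} \<in> B \<Longrightarrow> w \<in> words \<Longrightarrow> nb_walk (word_walk p x w)"
proof (induction w arbitrary: p x)
  case Nil
  then show ?case by (simp add: nb_walk_edge)
next
  case (Cons i w)
  then have i: "i < q" "w \<in> words" by (auto simp: words_def)
  note c = childD[OF Cons.prems(1) i(1)]
  obtain zs where zs: "word_walk x (child p x i) w = x # child p x i # zs"
    using word_walk_Cons by blast
  have "nb_walk (x # child p x i # zs)" using Cons.IH[OF c(1) i(2)] zs by simp
  then show ?case using c Cons.prems(1) zs by (simp add: nb_walk_Cons_iff[of p])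
qed

lemma word_walk_surj:
  "nb_walk (p # x # ys) \<Longrightarrow> \<exists>w\<in>words. word_walk p x w = p # x # ys"
proof (induction ys arbitrary: p x)
  case Nil
  then show ?case by (intro bexI[of _ "[]"]) (auto simp: words_def)
next
  case (Cons y ys)
  then have e: "{p, x} \<in> B" "y \<in> nbrs x - {p}" and n: "nb_walk (x # y # ys)"
    by (auto simp: nb_walk_Cons_iff nbrs_iff)
  from e(2) child_bij[OF e(1)] obtain i where i: "i < q" "y = child p x i"
    unfolding bij_betw_def by auto
  from Cons.IH[OF n] obtain w where "w \<in> words" "word_walk x y w = x # y # ys" by blast
  with i show ?case by (intro bexI[of _ "i # w"]) (auto simp: words_def)
qed

lemma word_walk_inj:
  "{p, x} \<in> B \<Longrightarrow> w \<in> words \<Longrightarrow> w' \<in> words \<Longrightarrow> word_walk p x w = word_walk p x w' \<Longrightarrow> w = w'"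
proof (induction w arbitrary: w' p x)
  case Nil
  from arg_cong[OF Nil(4), of length] show ?case by (simp add: length_word_walk)
next
  case (Cons i w)
  from arg_cong[OF Cons.prems(4), of length] obtain j v where w': "w' = j # v"
    by (cases w') (simp_all add: length_word_walk)
  have ij: "i < q" "j < q" "w \<in> words" "v \<in> words" using Cons.prems w' by (auto simp: words_def)
  have eq: "word_walk x (child p x i) w = word_walk x (child p x j) v"
    using Cons.prems w' by simp
  then have "child p x i = child p x j"
    using word_walk_Cons[of x "child p x i" w] word_walk_Cons[of x "child p x j" v] by auto
  then have "i = j"
    using child_bij[OF Cons.prems(1)] ij unfolding bij_betw_def inj_on_def by auto
  with Cons.IH[OF childD(1)[OF Cons.prems(1) ij(1)] ij(3,4)] eq w' show ?case by simp
qed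

lemma word_walk_snoc: "\<exists>y. word_walk p x (w @ [i]) = word_walk p x w @ [y]"
  by (induction w arbitrary: p x) auto

fun vertex_at :: "'s \<Rightarrow> 's \<Rightarrow> bool \<times> nat list \<Rightarrow> 's" where
  "vertex_at p x (b, w) = last (if b then word_walk p x w else word_walk x p w)"

abbreviation codes :: "(bool \<times> nat list) set" where "codes \<equiv> UNIV \<times> words"

text \<open>Adjacency in terms of the codes alone, with no reference to the tree or to the chosen
  edge. The last case is the base edge itself, whose ends are the empty words on the two
  sides.\<close>

fun code_adj :: "bool \<times> nat list \<Rightarrow> bool \<times> nat list \<Rightarrow> bool" where
  "code_adj (b, w) (b', w') \<longleftrightarrow>
     (b = b' \<and> (\<exists>i. w' = w @ [i] \<or> w = w' @ [i])) \<or> (b \<noteq> b' \<and> w = [] \<and> w' = [])"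

lemma vertex_at_swap: "vertex_at p x (b, w) = vertex_at x p (\<not> b, w)"
  by simp

lemma code_adj_swap: "code_adj (b, w) (b', w') = code_adj (\<not> b, w) (\<not> b', w')"
  by auto

text \<open>Words on one side are separated by uniqueness of non-backtracking walks. For words on
  opposite sides with the same end, reversing one walk and crossing the base edge into the other
  would give a closed non-backtracking walk.\<close>

lemma vertex_at_inj:
  assumes e: "{p, x} \<in> B" shows "inj_on (vertex_at p x) codes"
proof -
  have e': "{x, p} \<in> B" using e by (simp add: insert_commute)
  have 1: "w = w'" if h: "{a, b} \<in> B" "w \<in> words" "w' \<in> words"
    "last (word_walk a b w) = last (word_walk a b w')" for a b w w'
  proof -
    have "hd (word_walk a b w) = hd (word_walk a b w')"
      using word_walk_Cons[of a b w] word_walk_Cons[of a b w'] by auto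
    then have "word_walk a b w = word_walk a b w'"
      using h by (intro nb_walk_unique nb_walk_word_walk)
    with h show ?thesis by (intro word_walk_inj)
  qed
  have 2: False if h: "w \<in> words" "w' \<in> words" "last (word_walk p x w) = last (word_walk x p w')" for w w'
  proof -
    obtain zs where zs: "word_walk p x w = p # x # zs" using word_walk_Cons by blast
    obtain zs' where zs': "word_walk x p w' = x # p # zs'" using word_walk_Cons by blast
    have n: "nb_walk (p # x # zs)" "nb_walk (x # p # zs')"
      using nb_walk_word_walk[OF e h(1)] nb_walk_word_walk[OF e' h(2)] zs zs' by simp_all
    have "nb_walk (x # zs)" using n(1) by (simp add: nb_walk_Cons_iff)
    moreover have "zs \<noteq> [] \<Longrightarrow> hd zs \<noteq> p" using n(1) by (auto simp: nb_walk_Cons_iff)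
    ultimately have "nb_walk (rev zs @ x # p # zs')" using n(2) by (intro nb_walk_join) auto
    moreover have "hd (rev zs @ x # p # zs') = last (rev zs @ x # p # zs')"
      using h(3) zs zs' by (cases "zs = []") (auto simp: hd_rev)
    ultimately show False using nb_walk_closed by fastforce
  qed
  have "a = a'" if h: "a \<in> codes" "a' \<in> codes" "vertex_at p x a = vertex_at p x a'" for a a'
  proof -
    obtain b w b' w' where a: "a = (b, w)" "a' = (b', w')" by (cases a; cases a')
    with h have w: "w \<in> words" "w' \<in> words" by auto
    show ?thesis
      using 1[OF e w] 1[OF e' w] 2[OF w] 2[OF w(2,1)] h(3) unfolding a
      by (cases b; cases b') auto
  qed
  then show ?thesis by (rule inj_onI)
qed

lemma vertex_at_in_S:
  assumes "{p, x} \<in> B" "a \<in> codes" shows "vertex_at p x a \<in> S"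
proof -
  have *: "last xs \<in> S" if "nb_walk xs" for xs
    using that unfolding nb_walk_def graph_walk_def using last_in_set[of xs] by auto
  have "{x, p} \<in> B" using assms by (simp add: insert_commute)
  then show ?thesis using assms nb_walk_word_walk * by (cases a) auto
qed

text \<open>The walk from \<open>x\<close> to \<open>v\<close> either begins with the step to
  \<open>p\<close> or can be preceded by \<open>p\<close>; the two cases give the two sides.\<close>

lemma vertex_at_surj:
  assumes e: "{p, x} \<in> B" and "v \<in> S" shows "v \<in> vertex_at p x ` codes"
proof -
  have e': "{x, p} \<in> B" using e by (simp add: insert_commute)
  have "x \<in> S" using edgeD e by blast
  then obtain ys where ys: "nb_walk ys" "hd ys = x" "last ys = v"
    using nb_walk_exists assms(2) by blast
  then obtain xs where xs: "ys = x # xs" by (cases ys) (auto simp: nb_walk_def graph_walk_def)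
  show ?thesis
  proof (cases "xs \<noteq> [] \<and> hd xs = p")
    case True
    then obtain zs where zs: "xs = p # zs" by (cases xs) auto
    obtain w where "w \<in> words" "word_walk x p w = x # p # zs"
      using word_walk_surj ys(1) xs zs by blast
    then show ?thesis using ys(3) xs zs by (intro image_eqI[of _ _ "(False, w)"]) auto
  next
    case False
    then have "nb_walk (p # x # xs)" using ys(1) xs e by (auto simp: nb_walk_Cons_iff)
    then obtain w where "w \<in> words" "word_walk p x w = p # x # xs" using word_walk_surj by blast
    then show ?thesis using ys(3) xs by (intro image_eqI[of _ _ "(True, w)"]) auto
  qed
qed

lemma vertex_at_bij: "{p, x} \<in> B \<Longrightarrow> bij_betw (vertex_at p x) codes S"
  using vertex_at_inj vertex_at_in_S vertex_at_surj unfolding bij_betw_def by blast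

text \<open>A neighbour of the end of a word walk is either its last but one vertex, coded by the
  shortened word or by the other end of the base edge, or it extends the walk and is coded by a word
  with one more letter.\<close>

lemma vertex_at_adj_True:
  assumes e: "{p, x} \<in> B" and w: "w \<in> words" and a: "a \<in> codes"
    and adj: "{vertex_at p x (True, w), vertex_at p x a} \<in> B"
  shows "code_adj (True, w) a"
proof -
  define v where "v = vertex_at p x a"
  define xs where "xs = word_walk p x w"
  have eq: "a = c" if "c \<in> codes" "vertex_at p x c = v" for c
    using vertex_at_inj[OF e] a that unfolding v_def inj_on_def by metis
  have nb: "nb_walk xs" using nb_walk_word_walk[OF e w] by (simp add: xs_def)
  show ?thesis
  proof (cases "last (butlast xs) = v")
    case True
    show ?thesis
    proof (cases w rule: rev_cases)
      case Nil
      then have "v = p" using True by (simp add: xs_def)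
      then have "a = (False, [])" by (intro eq) (auto simp: words_def)
      then show ?thesis using Nil by simp
    next
      case (snoc u i)
      obtain y where "word_walk p x w = word_walk p x u @ [y]" using snoc word_walk_snoc by blast
      then have "a = (True, u)" using True snoc w by (intro eq) (auto simp: xs_def words_def)
      then show ?thesis using snoc by simp
    qed
  next
    case False
    then have "nb_walk (xs @ [v])" using nb adj by (intro nb_walk_snoc) (auto simp: xs_def v_def)
    moreover obtain zs where zs: "xs = p # x # zs" using word_walk_Cons xs_def by blast
    ultimately obtain u where u: "u \<in> words" "word_walk p x u = xs @ [v]"
      using word_walk_surj[of p x "zs @ [v]"] by auto
    have au: "a = (True, u)" using u by (intro eq) auto
    have "length u = Suc (length w)"
      using length_word_walk[of p x u] u length_word_walk[of p x w] xs_def by simp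
    then obtain u' i where u': "u = u' @ [i]" by (cases u rule: rev_cases) auto
    obtain y where "word_walk p x u = word_walk p x u' @ [y]" using u' word_walk_snoc by blast
    then have "word_walk p x u' = word_walk p x w" using u xs_def by simp
    then have "u' = w" using u u' w by (intro word_walk_inj[OF e]) (auto simp: words_def)
    then show ?thesis using au u' by simp
  qed
qed

lemma vertex_at_adj_snoc:
  assumes e: "{p, x} \<in> B" and w: "w @ [i] \<in> words"
  shows "{last (word_walk p x w), last (word_walk p x (w @ [i]))} \<in> B"
proof -
  obtain y where y: "word_walk p x (w @ [i]) = word_walk p x w @ [y]" using word_walk_snoc by blast
  have "nb_walk (rev (word_walk p x w @ [y]))"
    using nb_walk_word_walk[OF e w] y by (simp only: nb_walk_rev)
  moreover have ne: "word_walk p x w \<noteq> []" using length_word_walk[of p x w] by auto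
  then obtain us z where us: "word_walk p x w = us @ [z]" by (metis rev_exhaust)
  ultimately have "{y, z} \<in> B" by (simp add: nb_walk_Cons_iff)
  then show ?thesis using y us by (simp add: insert_commute)
qed

lemma vertex_at_adj:
  assumes e: "{p, x} \<in> B" and a: "a \<in> codes" and a': "a' \<in> codes"
  shows "{vertex_at p x a, vertex_at p x a'} \<in> B \<longleftrightarrow> code_adj a a'"
proof
  have e': "{x, p} \<in> B" using e by (simp add: insert_commute)
  obtain b w b' w' where bw: "a = (b, w)" "a' = (b', w')" by (cases a; cases a')
  have w: "w \<in> words" "w' \<in> words" using a a' bw by auto
  {
    assume adj: "{vertex_at p x a, vertex_at p x a'} \<in> B"
    show "code_adj a a'"
    proof (cases b)
      case True
      then show ?thesis using vertex_at_adj_True[OF e w(1) a'] adj bw by simp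
    next
      case False
      have "code_adj (True, w) (\<not> b', w')"
        using adj False w unfolding bw
        by (intro vertex_at_adj_True[OF e' w(1)]) (simp_all add: vertex_at_swap[of p] del: vertex_at.simps)
      then show ?thesis using code_adj_swap[of True w "\<not> b'" w'] False bw by simp
    qed
  next
    assume "code_adj a a'"
    then consider i where "b = b'" "w' = w @ [i]" | i where "b = b'" "w = w' @ [i]"
      | "b \<noteq> b'" "w = []" "w' = []"
      unfolding bw by auto
    then show "{vertex_at p x a, vertex_at p x a'} \<in> B"
    proof cases
      case 1
      then show ?thesis unfolding bw
        using vertex_at_adj_snoc[OF e, of w i] vertex_at_adj_snoc[OF e', of w i] w by auto
    next
      case 2
      then show ?thesis unfolding bw
        using vertex_at_adj_snoc[OF e, of w' i] vertex_at_adj_snoc[OF e', of w' i] w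
        by (auto simp: insert_commute)
    next
      case 3
      then show ?thesis unfolding bw using e e' by auto
    qed
  }
qed

text \<open>Passing to codes relative to one edge and back to vertices relative to the other
  preserves adjacency, because \<open>code_adj\<close> is the same for both. The color of a vertex
  is determined by its side, the parity of its word and the color of \<open>x\<close>, so equal
  colors of \<open>x\<close> and \<open>x'\<close> make the map color preserving.\<close>

lemma Aut0_transitive_on_edges:
  assumes e: "{p, x} \<in> B" and e': "{p', x'} \<in> B"
    and c: "two_coloring S B c" "c x = c x'"
  shows "\<exists>\<phi>\<in>Aut0 S B. \<phi> p = p' \<and> \<phi> x = x'"
proof -
  define \<phi> where "\<phi> = vertex_at p' x' \<circ> the_inv_into codes (vertex_at p x)"
  have at: "\<phi> (vertex_at p x a) = vertex_at p' x' a" if "a \<in> codes" for a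
    unfolding \<phi>_def o_def by (simp only: the_inv_into_f_f[OF vertex_at_inj[OF e] that])
  have bij: "bij_betw \<phi> S S"
    unfolding \<phi>_def by (rule bij_betw_trans[OF bij_betw_the_inv_into[OF vertex_at_bij[OF e]] vertex_at_bij[OF e']])
  have adj: "{\<phi> s, \<phi> t} \<in> B \<longleftrightarrow> {s, t} \<in> B" if "s \<in> S" "t \<in> S" for s t
  proof -
    from that vertex_at_surj[OF e] obtain a b where
      ab: "a \<in> codes" "b \<in> codes" "s = vertex_at p x a" "t = vertex_at p x b" by blast
    show ?thesis unfolding ab(3,4) at[OF ab(1)] at[OF ab(2)]
      using vertex_at_adj[OF e ab(1,2)] vertex_at_adj[OF e' ab(1,2)] by simp
  qed
  have col: "c (vertex_at r y (b, w)) = ((b = c y) = even (length w))"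
    if h: "{r, y} \<in> B" "w \<in> words" for r y b w
  proof -
    have h': "{y, r} \<in> B" using h by (simp add: insert_commute)
    have "c r \<noteq> c y" using c(1) h edgeD[of r y] by (auto simp: two_coloring_def)
    moreover have "hd (word_walk u z w) = u" for u z using word_walk_Cons[of u z w] by auto
    ultimately show ?thesis
      using nb_walk_color[OF c(1) nb_walk_word_walk[OF h]] nb_walk_color[OF c(1) nb_walk_word_walk[OF h' h(2)]]
      by (cases b) (auto simp: length_word_walk)
  qed
  have "c (\<phi> s) = c s" if s: "s \<in> S" for s
  proof -
    obtain a where a: "a \<in> codes" "s = vertex_at p x a" using vertex_at_surj[OF e s] by blast
    obtain b w where bw: "a = (b, w)" "w \<in> words" using a by (cases a) auto
    show ?thesis unfolding a(2) at[OF a(1)] using col[OF e bw(2)] col[OF e' bw(2)] c(2) bw(1) by simp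
  qed
  with bij adj c have "\<phi> \<in> Aut0 S B" unfolding Aut0_def graph_aut_def by blast
  moreover have "\<phi> p = p'" "\<phi> x = x'"
    using at[of "(False, [])"] at[of "(True, [])"] by (simp_all add: words_def)
  ultimately show ?thesis by blast
qed

section \<open>Images of neighbourhoods and descendant sets under automorphisms\<close>

lemma Aut0_image_nbrs:
  assumes "\<phi> \<in> Aut0 S B" "x \<in> S" shows "\<phi> ` nbrs x = nbrs (\<phi> x)"
proof -
  have b: "bij_betw \<phi> S S" and adj: "\<And>s t. s \<in> S \<Longrightarrow> t \<in> S \<Longrightarrow> {\<phi> s, \<phi> t} \<in> B \<longleftrightarrow> {s, t} \<in> B"
    using assms by (auto simp: Aut0_def graph_aut_def)
  show ?thesis
  proof
    show "\<phi> ` nbrs x \<subseteq> nbrs (\<phi> x)"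
      using adj assms(2) nbrs_subset by (auto simp: nbrs_iff subset_iff)
    show "nbrs (\<phi> x) \<subseteq> \<phi> ` nbrs x"
    proof
      fix t assume t: "t \<in> nbrs (\<phi> x)"
      then obtain s where "s \<in> S" "t = \<phi> s" using b nbrs_subset unfolding bij_betw_def by blast
      with t adj assms(2) show "t \<in> \<phi> ` nbrs x" by (auto simp: nbrs_iff)
    qed
  qed
qed

lemma Aut0_image_desc:
  assumes "\<phi> \<in> Aut0 S B" "{p, x} \<in> B" shows "\<phi> ` desc p x m = desc (\<phi> p) (\<phi> x) m"
  using assms(2)
proof (induction m arbitrary: p x)
  case (Suc m)
  have x: "p \<in> S" "x \<in> S" using edgeD Suc.prems by auto
  have inj: "inj_on \<phi> S" using assms by (auto simp: Aut0_def graph_aut_def bij_betw_def)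
  have "\<phi> ` desc p x (Suc m) = (\<Union>y\<in>nbrs x - {p}. desc (\<phi> x) (\<phi> y) m)"
    unfolding desc.simps image_UN using Suc.IH by (intro SUP_cong) (auto simp: nbrs_iff)
  also have "\<dots> = (\<Union>z\<in>\<phi> ` (nbrs x - {p}). desc (\<phi> x) z m)" by simp
  also have "\<phi> ` (nbrs x - {p}) = nbrs (\<phi> x) - {\<phi> p}"
    using inj_on_image_set_diff[OF inj, of "nbrs x" "{p}"] nbrs_subset x
      Aut0_image_nbrs[OF assms(1) x(2)] by auto
  finally show ?case by simp
qed simp

end

section \<open>Information functions of a process\<close>

text \<open>The inequality ln t \<le> t - 1 at t = 1 / s with s = sqrt p gives - ln s \<le> 1 / s,
  hence (ln p)^2 \<le> 4 / p.\<close>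

lemma mult_ln_squared_le:
  fixes p :: real assumes "0 \<le> p" "p \<le> 1" shows "p * (ln p)\<^sup>2 \<le> 4"
proof (cases "p = 0")
  case False
  then have p: "p > 0" using assms by simp
  define s where "s = sqrt p"
  have s: "s > 0" "s\<^sup>2 = p" "s \<le> 1" using p assms by (simp_all add: s_def)
  have "ln p = 2 * ln s" using s by (simp add: ln_realpow flip: s(2))
  moreover have "- ln s \<le> 1 / s"
    using ln_le_minus_one[of "1 / s"] s by (simp add: ln_div)
  moreover have "ln s \<le> 0" using s by simp
  ultimately have "(- ln p)\<^sup>2 \<le> (2 / s)\<^sup>2" by (intro power_mono) auto
  then have "(ln p)\<^sup>2 \<le> 4 / p" using s by (simp add: power_divide)
  then show ?thesis using p by (simp add: field_simps)
qed simp

text \<open>This is ln t \<le> t - 1 at t = 1 / (p N). Summed over N atoms, the terms in the bracket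
  cancel and the entropy bound ln N remains.\<close>

lemma mult_ln_le:
  fixes p N :: real assumes "0 \<le> p" "N > 0" shows "p * - ln p \<le> p * ln N + (1 / N - p)"
proof (cases "p = 0")
  case True
  with assms show ?thesis by simp
next
  case False
  then have p: "p > 0" using assms by simp
  have "ln (1 / (p * N)) \<le> 1 / (p * N) - 1" using p assms by (intro ln_le_minus_one) simp
  then have "- ln p - ln N \<le> 1 / (p * N) - 1" using p assms by (simp add: ln_div ln_mult)
  then have "p * (- ln p - ln N) \<le> p * (1 / (p * N) - 1)" using p by (intro mult_left_mono) simp_all
  also have "\<dots> = 1 / N - p" using p by (simp add: field_simps)
  finally show ?thesis by (simp add: algebra_simps)
qed

locale finite_process = prob_space M for M :: "'w measure" +
  fixes E :: "'e set" and S :: "'s set" and \<alpha> :: "'s \<Rightarrow> 'w \<Rightarrow> 'e"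
  assumes finite_E: "finite E" and process: "process M E S \<alpha>"
begin

abbreviation atom_prob :: "'s set \<Rightarrow> ('s \<Rightarrow> 'e) \<Rightarrow> real" where
  "atom_prob F i \<equiv> prob (joint_atom M \<alpha> F i)"

text \<open>Written through the atom containing \<omega> rather than as a sum over labels, so that
  ratios of atom probabilities become differences of \<open>info\<close>. The two forms agree on
  \<open>space M\<close> by \<open>process_information_eq\<close>.\<close>

definition info :: "'s set \<Rightarrow> 'w \<Rightarrow> real" where
  "info F \<omega> = - ln (atom_prob F (\<lambda>s. \<alpha> s \<omega>))"

lemma process_in_E: "s \<in> S \<Longrightarrow> \<omega> \<in> space M \<Longrightarrow> \<alpha> s \<omega> \<in> E"
  using process measurable_space[of "\<alpha> s" M "count_space E" \<omega>] by (auto simp: process_def)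

section \<open>Atoms and functions of finitely many labels\<close>

lemma joint_atom_sets [measurable]:
  assumes "finite F" "F \<subseteq> S" shows "joint_atom M \<alpha> F i \<in> sets M"
proof -
  have "{\<omega> \<in> space M. \<alpha> s \<omega> = i s} \<in> sets M" if "s \<in> F" for s
  proof -
    have "\<alpha> s -` ({i s} \<inter> E) \<inter> space M \<in> sets M"
      using process that assms by (intro measurable_sets[of _ _ "count_space E"]) (auto simp: process_def)
    also have "\<alpha> s -` ({i s} \<inter> E) \<inter> space M = {\<omega> \<in> space M. \<alpha> s \<omega> = i s}"
      using process_in_E that assms by auto
    finally show ?thesis .
  qed
  then show ?thesis unfolding joint_atom_def using assms by (intro sets.sets_Collect_finite_All) auto
qed

lemma joint_atom_cong: "(\<And>s. s \<in> F \<Longrightarrow> i s = j s) \<Longrightarrow> joint_atom M \<alpha> F i = joint_atom M \<alpha> F j"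
  by (auto simp: joint_atom_def)

lemma finite_labels: "finite F \<Longrightarrow> finite (F \<rightarrow>\<^sub>E E)"
  using finite_E by (intro finite_PiE) auto

text \<open>Only the atom of the labels read off at \<omega> contains \<omega>, so the sum
  collapses. Thus every function of finitely many labels is a finite combination of indicators,
  which gives its integrability and its expectation.\<close>

lemma sum_indicator_atoms:
  assumes "finite F" "F \<subseteq> S" "\<omega> \<in> space M"
  shows "(\<Sum>i\<in>F \<rightarrow>\<^sub>E E. indicator (joint_atom M \<alpha> F i) \<omega> * g i) = (g (\<lambda>s\<in>F. \<alpha> s \<omega>) :: real)"
proof -
  let ?r = "\<lambda>s\<in>F. \<alpha> s \<omega>"
  have r: "?r \<in> F \<rightarrow>\<^sub>E E" using process_in_E assms by auto
  have "indicator (joint_atom M \<alpha> F i) \<omega> * g i = (if i = ?r then g i else 0)" if "i \<in> F \<rightarrow>\<^sub>E E" for i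
  proof -
    have "i = ?r" if "\<omega> \<in> joint_atom M \<alpha> F i"
      using that \<open>i \<in> F \<rightarrow>\<^sub>E E\<close> r by (intro PiE_ext[of i F _ ?r]) (auto simp: joint_atom_def)
    moreover have "\<omega> \<in> joint_atom M \<alpha> F ?r" using assms(3) by (simp add: joint_atom_def)
    ultimately show ?thesis by (cases "i = ?r") (auto simp: indicator_def)
  qed
  then have "(\<Sum>i\<in>F \<rightarrow>\<^sub>E E. indicator (joint_atom M \<alpha> F i) \<omega> * g i) = (\<Sum>i\<in>F \<rightarrow>\<^sub>E E. if i = ?r then g i else 0)"
    by (intro sum.cong) auto
  also have "\<dots> = g ?r" using r finite_labels[OF assms(1)] by simp
  finally show ?thesis .
qed

lemma integrable_atoms:
  assumes "finite F" "F \<subseteq> S"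
  shows "integrable M (\<lambda>\<omega>. \<Sum>i\<in>F \<rightarrow>\<^sub>E E. indicator (joint_atom M \<alpha> F i) \<omega> * g i :: real)"
  using assms by (intro Bochner_Integration.integrable_sum integrable_mult_left integrable_real_indicator)
      (auto simp: less_top[symmetric])

lemma integrable_function_of_labels:
  assumes "finite F" "F \<subseteq> S"
  shows "integrable M (\<lambda>\<omega>. g (\<lambda>s\<in>F. \<alpha> s \<omega>) :: real)"
  using integrable_atoms[OF assms, of g] sum_indicator_atoms[OF assms, of _ g]
  by (subst Bochner_Integration.integrable_cong[OF refl]) auto

lemma expectation_function_of_labels:
  assumes "finite F" "F \<subseteq> S"
  shows "expectation (\<lambda>\<omega>. g (\<lambda>s\<in>F. \<alpha> s \<omega>) :: real) = (\<Sum>i\<in>F \<rightarrow>\<^sub>E E. atom_prob F i * g i)"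
proof -
  have "expectation (\<lambda>\<omega>. g (\<lambda>s\<in>F. \<alpha> s \<omega>)) =
      expectation (\<lambda>\<omega>. \<Sum>i\<in>F \<rightarrow>\<^sub>E E. indicator (joint_atom M \<alpha> F i) \<omega> * g i)"
    using sum_indicator_atoms[OF assms, of _ g] by (intro Bochner_Integration.integral_cong) auto
  also have "\<dots> = (\<Sum>i\<in>F \<rightarrow>\<^sub>E E. expectation (\<lambda>\<omega>. indicator (joint_atom M \<alpha> F i) \<omega> * g i))"
    using assms by (intro Bochner_Integration.integral_sum integrable_mult_left integrable_real_indicator)
      (auto simp: less_top[symmetric])
  also have "\<dots> = (\<Sum>i\<in>F \<rightarrow>\<^sub>E E. atom_prob F i * g i)"
    using assms by (intro sum.cong) (simp_all add: joint_atom_sets)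
  finally show ?thesis .
qed

lemma sum_atom_prob: "finite F \<Longrightarrow> F \<subseteq> S \<Longrightarrow> (\<Sum>i\<in>F \<rightarrow>\<^sub>E E. atom_prob F i) = 1"
  using expectation_function_of_labels[of F "\<lambda>_. 1"] by (simp add: prob_space)

lemma info_eq: "info F \<omega> = - ln (atom_prob F (\<lambda>s\<in>F. \<alpha> s \<omega>))"
  unfolding info_def by (subst joint_atom_cong[of F _ "\<lambda>s\<in>F. \<alpha> s \<omega>"]) auto

lemma process_information_eq:
  assumes "finite F" "F \<subseteq> S" "\<omega> \<in> space M"
  shows "process_information M E \<alpha> F \<omega> = info F \<omega>"
  unfolding process_information_def information_fun_def info_eq
  using sum_indicator_atoms[OF assms, of "\<lambda>i. ln (atom_prob F i)"] by simp

lemma info_nonneg: "info F \<omega> \<ge> 0"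
proof -
  have "ln p \<le> 0" if "0 \<le> p" "p \<le> 1" for p :: real
    using that by (cases "p = 0") auto
  then show ?thesis unfolding info_def by simp
qed

lemma integrable_info: "finite F \<Longrightarrow> F \<subseteq> S \<Longrightarrow> integrable M (info F)"
  unfolding info_eq using integrable_function_of_labels[of F "\<lambda>i. - ln (atom_prob F i)"] .

lemma expectation_info:
  assumes "finite F" "F \<subseteq> S"
  shows "expectation (info F) = (\<Sum>i\<in>F \<rightarrow>\<^sub>E E. atom_prob F i * - ln (atom_prob F i))"
  unfolding info_eq using expectation_function_of_labels[OF assms, of "\<lambda>i. - ln (atom_prob F i)"] .

lemma expectation_info_nonneg: "expectation (info F) \<ge> 0"
  by (simp add: info_nonneg)

lemma expectation_info_le:
  assumes "finite F" "F \<subseteq> S"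
  shows "expectation (info F) \<le> real (card F) * ln (real (card E))"
proof -
  define N where "N = real (card (F \<rightarrow>\<^sub>E E))"
  have "F \<rightarrow>\<^sub>E E \<noteq> {}" using sum_atom_prob[OF assms] by auto
  then have N: "N > 0" using finite_labels[OF assms(1)] by (simp add: N_def card_gt_0_iff)
  have N_eq: "N = real (card E) ^ card F" unfolding N_def using assms(1) by (simp add: card_PiE)
  have "expectation (info F) \<le> (\<Sum>i\<in>F \<rightarrow>\<^sub>E E. atom_prob F i * ln N + (1 / N - atom_prob F i))"
    unfolding expectation_info[OF assms] using N by (intro sum_mono mult_ln_le) simp_all
  also have "\<dots> = ln N"
    using sum_atom_prob[OF assms] N
    by (simp add: sum.distrib sum_subtractf flip: sum_distrib_right N_def)
  also have "ln N = real (card F) * ln (real (card E))"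
    using N unfolding N_eq by (cases "card F = 0") (auto simp: ln_realpow zero_less_power_eq)
  finally show ?thesis .
qed

lemma integrable_info_mult:
  assumes "finite U" "U \<subseteq> S" "finite V" "V \<subseteq> S"
  shows "integrable M (\<lambda>\<omega>. info U \<omega> * info V \<omega>)"
proof -
  \<comment> \<open>Both factors are read off from one labelling of the union, so the product is
    again a function of finitely many labels.\<close>
  define g where "g i = (- ln (atom_prob U (restrict i U))) * (- ln (atom_prob V (restrict i V)))" for i
  have "info U \<omega> * info V \<omega> = g (\<lambda>s\<in>U \<union> V. \<alpha> s \<omega>)" for \<omega>
    by (simp add: g_def info_eq restrict_restrict Int_absorb1 Un_Int_distrib2 Int_absorb2 Un_commute Int_commute)
  then show ?thesis using integrable_function_of_labels[of "U \<union> V" g] assms by simp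
qed

text \<open>Each of the |E|^|F| labellings contributes at most 4. The bound is crude; it serves to
  start the variance induction at a fixed depth.\<close>

lemma expectation_info_square_le:
  assumes "finite F" "F \<subseteq> S"
  shows "expectation (\<lambda>\<omega>. (info F \<omega>)\<^sup>2) \<le> 4 * real (card E) ^ card F"
proof -
  have "expectation (\<lambda>\<omega>. (info F \<omega>)\<^sup>2) = (\<Sum>i\<in>F \<rightarrow>\<^sub>E E. atom_prob F i * (- ln (atom_prob F i))\<^sup>2)"
    unfolding info_eq using expectation_function_of_labels[OF assms, of "\<lambda>i. (- ln (atom_prob F i))\<^sup>2"] .
  also have "\<dots> \<le> (\<Sum>i\<in>F \<rightarrow>\<^sub>E E. 4)"
    by (intro sum_mono) (simp add: mult_ln_squared_le)
  also have "\<dots> = 4 * real (card E) ^ card F" using assms(1) by (simp add: card_PiE)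
  finally show ?thesis .
qed

section \<open>Consequences of a bound on the \<psi>-coefficient\<close>

lemma joint_atom_Int:
  "joint_atom M \<alpha> U i \<inter> joint_atom M \<alpha> V i = joint_atom M \<alpha> (U \<union> V) i"
  by (auto simp: joint_atom_def)

text \<open>Multiplying out the quotient removes the restriction to atoms of positive measure: if
  one of the two atoms is null, so is the intersection, and both sides vanish.\<close>

lemma psi_coeff_upper:
  assumes "finite U" "U \<subseteq> S" "finite V" "V \<subseteq> S" "i \<in> U \<rightarrow>\<^sub>E E" "j \<in> V \<rightarrow>\<^sub>E E"
  shows "\<bar>prob (joint_atom M \<alpha> U i \<inter> joint_atom M \<alpha> V j) - atom_prob U i * atom_prob V j\<bar>
     \<le> psi_coeff M E \<alpha> U V * (atom_prob U i * atom_prob V j)"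
proof (cases "atom_prob U i * atom_prob V j > 0")
  case True
  define r where "r i j = \<bar>prob (joint_atom M \<alpha> U i \<inter> joint_atom M \<alpha> V j) / (atom_prob U i * atom_prob V j) - 1\<bar>" for i j
  define R where "R = {r i j | i j. i \<in> U \<rightarrow>\<^sub>E E \<and> j \<in> V \<rightarrow>\<^sub>E E \<and> atom_prob U i * atom_prob V j > 0}"
  have "R \<subseteq> (\<lambda>(i, j). r i j) ` ((U \<rightarrow>\<^sub>E E) \<times> (V \<rightarrow>\<^sub>E E))" unfolding R_def by auto
  then have "finite R" by (rule finite_subset) (intro finite_imageI finite_SigmaI finite_labels assms)
  moreover have "r i j \<in> R" using assms True unfolding R_def by blast
  ultimately have "r i j \<le> Sup R" by (intro cSup_upper) auto
  then have le: "r i j \<le> psi_coeff M E \<alpha> U V" unfolding psi_coeff_def R_def r_def .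
  have "prob (joint_atom M \<alpha> U i \<inter> joint_atom M \<alpha> V j) - atom_prob U i * atom_prob V j
    = (prob (joint_atom M \<alpha> U i \<inter> joint_atom M \<alpha> V j) / (atom_prob U i * atom_prob V j) - 1) * (atom_prob U i * atom_prob V j)"
    using True by (auto simp: left_diff_distrib)
  then have "\<bar>prob (joint_atom M \<alpha> U i \<inter> joint_atom M \<alpha> V j) - atom_prob U i * atom_prob V j\<bar>
    = r i j * (atom_prob U i * atom_prob V j)"
    using True by (simp add: r_def abs_mult)
  then show ?thesis using mult_right_mono[OF le, of "atom_prob U i * atom_prob V j"] True by simp
next
  case False
  then have z: "atom_prob U i * atom_prob V j = 0"
    by (meson measure_nonneg mult_nonneg_nonneg not_less order_antisym)
  have "prob (joint_atom M \<alpha> U i \<inter> joint_atom M \<alpha> V j) \<le> atom_prob U i"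
    "prob (joint_atom M \<alpha> U i \<inter> joint_atom M \<alpha> V j) \<le> atom_prob V j"
    using assms joint_atom_sets by (auto intro!: finite_measure_mono)
  then have "prob (joint_atom M \<alpha> U i \<inter> joint_atom M \<alpha> V j) = 0"
    using z by (auto intro: order_antisym)
  then show ?thesis unfolding z by simp
qed

text \<open>Both expectations are sums over pairs of atoms with nonnegative weights
  \<open>f i * g j\<close>, so the mixing bound for single pairs survives summation. The error is
  relative to the product of the entropies, which stays bounded after normalisation.\<close>

lemma covariance_info_le:
  assumes UV: "finite U" "U \<subseteq> S" "finite V" "V \<subseteq> S" and b: "psi_coeff M E \<alpha> U V \<le> b"
  shows "\<bar>expectation (\<lambda>\<omega>. info U \<omega> * info V \<omega>) - expectation (info U) * expectation (info V)\<bar>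
     \<le> b * (expectation (info U) * expectation (info V))"
proof -
  define f where "f i = - ln (atom_prob U i)" for i
  define g where "g i = - ln (atom_prob V i)" for i
  have nn: "f i \<ge> 0" "g i \<ge> 0" for i
  proof -
    have "ln p \<le> 0" if "0 \<le> p" "p \<le> 1" for p :: real
      using that by (cases "p = 0") auto
    then show "f i \<ge> 0" "g i \<ge> 0" by (simp_all add: f_def g_def)
  qed
  let ?P = "\<lambda>i j. prob (joint_atom M \<alpha> U i \<inter> joint_atom M \<alpha> V j)"
  have "expectation (\<lambda>\<omega>. info U \<omega> * info V \<omega>) = expectation (\<lambda>\<omega>. \<Sum>i\<in>U \<rightarrow>\<^sub>E E. \<Sum>j\<in>V \<rightarrow>\<^sub>E E.
      indicator (joint_atom M \<alpha> U i \<inter> joint_atom M \<alpha> V j) \<omega> * (f i * g j))"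
  proof (intro Bochner_Integration.integral_cong refl)
    fix \<omega> assume w: "\<omega> \<in> space M"
    have "info U \<omega> * info V \<omega> = (\<Sum>i\<in>U \<rightarrow>\<^sub>E E. indicator (joint_atom M \<alpha> U i) \<omega> * f i) *
        (\<Sum>j\<in>V \<rightarrow>\<^sub>E E. indicator (joint_atom M \<alpha> V j) \<omega> * g j)"
      using sum_indicator_atoms[OF UV(1,2) w, of f] sum_indicator_atoms[OF UV(3,4) w, of g]
      by (simp add: f_def g_def info_eq)
    then show "info U \<omega> * info V \<omega> = (\<Sum>i\<in>U \<rightarrow>\<^sub>E E. \<Sum>j\<in>V \<rightarrow>\<^sub>E E.
      indicator (joint_atom M \<alpha> U i \<inter> joint_atom M \<alpha> V j) \<omega> * (f i * g j))"
      by (simp add: sum_product indicator_inter_arith mult_ac)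
  qed
  also have "\<dots> = (\<Sum>i\<in>U \<rightarrow>\<^sub>E E. \<Sum>j\<in>V \<rightarrow>\<^sub>E E. ?P i j * (f i * g j))"
  proof -
    have [measurable]: "joint_atom M \<alpha> U i \<in> sets M" "joint_atom M \<alpha> V j \<in> sets M" for i j
      using UV joint_atom_sets by auto
    have *: "integrable M (\<lambda>\<omega>. indicator (joint_atom M \<alpha> U i \<inter> joint_atom M \<alpha> V j) \<omega> * (f i * g j))" for i j
      by (intro integrable_mult_left integrable_real_indicator) (auto simp: less_top[symmetric])
    have "expectation (\<lambda>\<omega>. \<Sum>i\<in>U \<rightarrow>\<^sub>E E. \<Sum>j\<in>V \<rightarrow>\<^sub>E E.
        indicator (joint_atom M \<alpha> U i \<inter> joint_atom M \<alpha> V j) \<omega> * (f i * g j)) =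
      (\<Sum>i\<in>U \<rightarrow>\<^sub>E E. \<Sum>j\<in>V \<rightarrow>\<^sub>E E. expectation (\<lambda>\<omega>.
        indicator (joint_atom M \<alpha> U i \<inter> joint_atom M \<alpha> V j) \<omega> * (f i * g j)))"
      by (subst Bochner_Integration.integral_sum, intro Bochner_Integration.integrable_sum *)
         (intro sum.cong refl Bochner_Integration.integral_sum *)
    then show ?thesis by (simp add: Int_absorb2 sets.sets_into_space)
  qed
  finally have 1: "expectation (\<lambda>\<omega>. info U \<omega> * info V \<omega>)
      = (\<Sum>i\<in>U \<rightarrow>\<^sub>E E. \<Sum>j\<in>V \<rightarrow>\<^sub>E E. ?P i j * (f i * g j))" .
  have 2: "expectation (info U) * expectation (info V) =
      (\<Sum>i\<in>U \<rightarrow>\<^sub>E E. \<Sum>j\<in>V \<rightarrow>\<^sub>E E. (atom_prob U i * atom_prob V j) * (f i * g j))"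
    unfolding expectation_info[OF UV(1,2)] expectation_info[OF UV(3,4)] sum_product f_def g_def
    by (intro sum.cong refl) simp
  have "\<bar>expectation (\<lambda>\<omega>. info U \<omega> * info V \<omega>) - expectation (info U) * expectation (info V)\<bar> =
     \<bar>\<Sum>i\<in>U \<rightarrow>\<^sub>E E. \<Sum>j\<in>V \<rightarrow>\<^sub>E E. (?P i j - atom_prob U i * atom_prob V j) * (f i * g j)\<bar>"
    unfolding 1 2 by (simp add: sum_subtractf left_diff_distrib)
  also have "\<dots> \<le> (\<Sum>i\<in>U \<rightarrow>\<^sub>E E. \<bar>\<Sum>j\<in>V \<rightarrow>\<^sub>E E. (?P i j - atom_prob U i * atom_prob V j) * (f i * g j)\<bar>)"
    by (rule sum_abs)
  also have "\<dots> \<le> (\<Sum>i\<in>U \<rightarrow>\<^sub>E E. \<Sum>j\<in>V \<rightarrow>\<^sub>E E. \<bar>(?P i j - atom_prob U i * atom_prob V j) * (f i * g j)\<bar>)"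
    by (intro sum_mono sum_abs)
  also have "\<dots> \<le> (\<Sum>i\<in>U \<rightarrow>\<^sub>E E. \<Sum>j\<in>V \<rightarrow>\<^sub>E E. b * (atom_prob U i * atom_prob V j) * (f i * g j))"
  proof (intro sum_mono)
    fix i j assume ij: "i \<in> U \<rightarrow>\<^sub>E E" "j \<in> V \<rightarrow>\<^sub>E E"
    have "\<bar>?P i j - atom_prob U i * atom_prob V j\<bar> \<le> psi_coeff M E \<alpha> U V * (atom_prob U i * atom_prob V j)"
      using psi_coeff_upper[OF UV ij] .
    also have "\<dots> \<le> b * (atom_prob U i * atom_prob V j)"
      using b by (intro mult_right_mono) auto
    finally show "\<bar>(?P i j - atom_prob U i * atom_prob V j) * (f i * g j)\<bar>
        \<le> b * (atom_prob U i * atom_prob V j) * (f i * g j)"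
      unfolding abs_mult using nn[of i] nn[of j] by (intro mult_mono) auto
  qed
  also have "\<dots> = b * (expectation (info U) * expectation (info V))"
    unfolding 2 by (simp add: sum_distrib_left mult.assoc)
  finally show ?thesis .
qed

text \<open>There are finitely many null atoms to discard. Without this the logarithm of a quotient
  of atom probabilities could not be split, as \<open>ln 0\<close> is a default value.\<close>

lemma AE_atom_prob_pos:
  assumes "finite F" "F \<subseteq> S"
  shows "AE \<omega> in M. atom_prob F (\<lambda>s. \<alpha> s \<omega>) > 0"
proof -
  have "AE \<omega> in M. \<omega> \<in> joint_atom M \<alpha> F i \<longrightarrow> atom_prob F i > 0" for i
  proof (cases "atom_prob F i > 0")
    case False
    then have "atom_prob F i = 0" using measure_nonneg[of M "joint_atom M \<alpha> F i"] by linarith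
    then have "joint_atom M \<alpha> F i \<in> null_sets M"
      using assms joint_atom_sets by (simp add: null_sets_def emeasure_eq_measure)
    from AE_not_in[OF this] show ?thesis by eventually_elim simp
  qed simp
  then have "AE \<omega> in M. \<forall>i\<in>F \<rightarrow>\<^sub>E E. \<omega> \<in> joint_atom M \<alpha> F i \<longrightarrow> atom_prob F i > 0"
    using finite_labels[OF assms(1)] by (intro AE_finite_allI)
  then show ?thesis
  proof (rule AE_mp, intro AE_I2 impI)
    fix \<omega> assume w: "\<omega> \<in> space M" "\<forall>i\<in>F \<rightarrow>\<^sub>E E. \<omega> \<in> joint_atom M \<alpha> F i \<longrightarrow> atom_prob F i > 0"
    have "(\<lambda>s\<in>F. \<alpha> s \<omega>) \<in> F \<rightarrow>\<^sub>E E" "\<omega> \<in> joint_atom M \<alpha> F (\<lambda>s\<in>F. \<alpha> s \<omega>)"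
      using process_in_E assms w by (auto simp: joint_atom_def)
    with w have "atom_prob F (\<lambda>s\<in>F. \<alpha> s \<omega>) > 0" by blast
    then show "atom_prob F (\<lambda>s. \<alpha> s \<omega>) > 0"
      by (subst joint_atom_cong[of F _ "\<lambda>s\<in>F. \<alpha> s \<omega>"]) auto
  qed
qed

text \<open>Up to sign the difference is ln (1 + y), where y is the relative mixing error at
  \<omega> and |y| \<le> b. For |y| \<le> 1/2 one has 2 y^2 \<le> |y|, hence |ln (1 + y)| \<le> |y|
  + 2 y^2 \<le> 2 |y|.\<close>

lemma AE_info_Un:
  assumes UV: "finite U" "U \<subseteq> S" "finite V" "V \<subseteq> S"
    and b: "psi_coeff M E \<alpha> U V \<le> b" "b \<le> 1 / 2"
  shows "AE \<omega> in M. \<bar>info (U \<union> V) \<omega> - info U \<omega> - info V \<omega>\<bar> \<le> 2 * b"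
  using AE_atom_prob_pos[OF UV(1,2)] AE_atom_prob_pos[OF UV(3,4)] AE_space
    AE_atom_prob_pos[of "U \<union> V", OF finite_UnI[OF UV(1,3)] Un_least[OF UV(2,4)]]
proof eventually_elim
  case (elim \<omega>)
  define x where "x = (\<lambda>s. \<alpha> s \<omega>)"
  have pos: "atom_prob U x > 0" "atom_prob V x > 0" "atom_prob (U \<union> V) x > 0"
    using elim by (simp_all add: x_def)
  have r: "restrict x U \<in> U \<rightarrow>\<^sub>E E" "restrict x V \<in> V \<rightarrow>\<^sub>E E"
    using process_in_E UV elim by (auto simp: x_def)
  have c: "joint_atom M \<alpha> U (restrict x U) = joint_atom M \<alpha> U x"
    "joint_atom M \<alpha> V (restrict x V) = joint_atom M \<alpha> V x"
    by (auto intro!: joint_atom_cong)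
  have "\<bar>atom_prob (U \<union> V) x - atom_prob U x * atom_prob V x\<bar>
      \<le> psi_coeff M E \<alpha> U V * (atom_prob U x * atom_prob V x)"
    using psi_coeff_upper[OF UV r] unfolding c joint_atom_Int .
  also have "\<dots> \<le> b * (atom_prob U x * atom_prob V x)"
    using b pos by (intro mult_right_mono) auto
  finally have le: "\<bar>atom_prob (U \<union> V) x - atom_prob U x * atom_prob V x\<bar> \<le> b * (atom_prob U x * atom_prob V x)" .
  define y where "y = atom_prob (U \<union> V) x / (atom_prob U x * atom_prob V x) - 1"
  have "y = (atom_prob (U \<union> V) x - atom_prob U x * atom_prob V x) / (atom_prob U x * atom_prob V x)"
    unfolding y_def using pos by (simp add: diff_divide_distrib)
  then have "\<bar>y\<bar> = \<bar>atom_prob (U \<union> V) x - atom_prob U x * atom_prob V x\<bar> / (atom_prob U x * atom_prob V x)"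
    using pos by (simp add: abs_divide)
  also have "\<dots> \<le> b" using le pos by (simp add: pos_divide_le_eq)
  finally have y: "\<bar>y\<bar> \<le> b" .
  have "y\<^sup>2 \<le> \<bar>y\<bar> * (1 / 2)"
  proof -
    have "\<bar>y\<bar> * \<bar>y\<bar> \<le> \<bar>y\<bar> * (1 / 2)" using y b by (intro mult_left_mono) auto
    then show ?thesis by (simp add: power2_eq_square)
  qed
  moreover have "\<bar>ln (1 + y) - y\<bar> \<le> 2 * y\<^sup>2"
    using y b by (intro abs_ln_one_plus_x_minus_x_bound) simp
  ultimately have "\<bar>ln (1 + y)\<bar> \<le> 2 * b" using y by linarith
  moreover have "ln (1 + y) = info U \<omega> + info V \<omega> - info (U \<union> V) \<omega>"
    using pos by (simp add: y_def info_def x_def ln_div ln_mult)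
  ultimately show ?case by simp
qed

section \<open>Invariance of entropies under automorphisms\<close>

lemma process_law_cylinder:
  assumes "finite F" "F \<subseteq> S"
  shows "{x \<in> S \<rightarrow>\<^sub>E E. \<forall>s\<in>F. x s = i s} \<in> sets (process_law M E S \<alpha>)"
    and "measure (process_law M E S \<alpha>) {x \<in> S \<rightarrow>\<^sub>E E. \<forall>s\<in>F. x s = i s} = atom_prob F i"
proof -
  let ?N = "PiM S (\<lambda>_. count_space E)"
  let ?A = "{x \<in> S \<rightarrow>\<^sub>E E. \<forall>s\<in>F. x s = i s}"
  have sp: "space ?N = S \<rightarrow>\<^sub>E E" by (simp add: space_PiM)
  have "{x \<in> space ?N. x s = i s} \<in> sets ?N" if "s \<in> F" for s
  proof -
    have "(\<lambda>x. x s) -` ({i s} \<inter> E) \<inter> space ?N \<in> sets ?N"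
      using that assms by (intro measurable_sets[OF measurable_component_singleton]) auto
    also have "(\<lambda>x. x s) -` ({i s} \<inter> E) \<inter> space ?N = {x \<in> space ?N. x s = i s}"
      using that assms by (auto simp: sp)
    finally show ?thesis .
  qed
  then have A: "?A \<in> sets ?N"
    unfolding sp[symmetric] using assms(1) by (intro sets.sets_Collect_finite_All) auto
  then show "?A \<in> sets (process_law M E S \<alpha>)" by (simp add: process_law_def)
  have m: "(\<lambda>\<omega>. \<lambda>s\<in>S. \<alpha> s \<omega>) \<in> measurable M ?N"
    using process by (intro measurable_restrict) (simp add: process_def)
  have "(\<lambda>\<omega>. \<lambda>s\<in>S. \<alpha> s \<omega>) -` ?A \<inter> space M = joint_atom M \<alpha> F i"
    using assms process_in_E by (auto simp: joint_atom_def subset_iff)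
  then show "measure (process_law M E S \<alpha>) ?A = atom_prob F i"
    unfolding process_law_def using measure_distr[OF m A] by simp
qed

text \<open>The action reads a configuration through the inverse of \<phi>, so a condition at
  \<open>s\<close> moves to \<open>\<phi> s\<close>.\<close>

lemma shift_action_cylinder:
  assumes b: "bij_betw \<phi> S S" and F: "F \<subseteq> S"
  shows "shift_action S \<phi> ` {x \<in> S \<rightarrow>\<^sub>E E. \<forall>s\<in>F. x s = i (\<phi> s)} = {x \<in> S \<rightarrow>\<^sub>E E. \<forall>t\<in>\<phi> ` F. x t = i t}"
proof -
  have inj: "inj_on \<phi> S" and im: "\<phi> ` S = S" using b by (auto simp: bij_betw_def)
  have inv: "the_inv_into S \<phi> (\<phi> s) = s" if "s \<in> S" for s using that inj by (rule the_inv_into_f_f[rotated])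
  have inv_in: "the_inv_into S \<phi> t \<in> S" if "t \<in> S" for t
    using that inj im by (metis order_refl the_inv_into_into)
  have inv': "\<phi> (the_inv_into S \<phi> t) = t" if "t \<in> S" for t
    using that inj im by (simp add: f_the_inv_into_f)
  show ?thesis
  proof (intro subset_antisym subsetI)
    fix y assume "y \<in> shift_action S \<phi> ` {x \<in> S \<rightarrow>\<^sub>E E. \<forall>s\<in>F. x s = i (\<phi> s)}"
    then obtain x where x: "x \<in> S \<rightarrow>\<^sub>E E" "\<And>s. s \<in> F \<Longrightarrow> x s = i (\<phi> s)" "y = shift_action S \<phi> x" by auto
    have "y \<in> S \<rightarrow>\<^sub>E E" using x inv_in by (auto simp: shift_action_def)
    moreover have "y (\<phi> s) = i (\<phi> s)" if "s \<in> F" for s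
      using x that F im inv by (auto simp: shift_action_def subset_iff)
    ultimately show "y \<in> {x \<in> S \<rightarrow>\<^sub>E E. \<forall>t\<in>\<phi> ` F. x t = i t}" by auto
  next
    fix y assume y: "y \<in> {x \<in> S \<rightarrow>\<^sub>E E. \<forall>t\<in>\<phi> ` F. x t = i t}"
    define x where "x = (\<lambda>s\<in>S. y (\<phi> s))"
    have "x \<in> S \<rightarrow>\<^sub>E E" using y im by (auto simp: x_def)
    moreover have "\<forall>s\<in>F. x s = i (\<phi> s)" using y F by (auto simp: x_def)
    moreover have "y = shift_action S \<phi> x"
    proof (rule PiE_ext)
      show "y \<in> S \<rightarrow>\<^sub>E E" using y by simp
      show "shift_action S \<phi> x \<in> S \<rightarrow>\<^sub>E E"
        using \<open>x \<in> S \<rightarrow>\<^sub>E E\<close> inv_in by (auto simp: shift_action_def)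
      show "y t = shift_action S \<phi> x t" if "t \<in> S" for t
        using that inv_in inv' by (simp add: shift_action_def x_def)
    qed
    ultimately show "y \<in> shift_action S \<phi> ` {x \<in> S \<rightarrow>\<^sub>E E. \<forall>s\<in>F. x s = i (\<phi> s)}" by blast
  qed
qed

text \<open>Invariance concerns the law, so atoms are first turned into cylinder sets; then the two
  entropy sums agree term by term after relabelling along \<phi>.\<close>

lemma expectation_info_image:
  assumes G: "invariant_law S G (process_law M E S \<alpha>)" "\<phi> \<in> G" "bij_betw \<phi> S S"
    and F: "finite F" "F \<subseteq> S"
  shows "expectation (info (\<phi> ` F)) = expectation (info F)"
proof -
  have inj: "inj_on \<phi> S" and im: "\<phi> ` S = S" using G by (auto simp: bij_betw_def)
  have F': "finite (\<phi> ` F)" "\<phi> ` F \<subseteq> S" using F im by auto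
  have p: "atom_prob (\<phi> ` F) i = atom_prob F (\<lambda>s. i (\<phi> s))" for i
  proof -
    have "atom_prob (\<phi> ` F) i = measure (process_law M E S \<alpha>) {x \<in> S \<rightarrow>\<^sub>E E. \<forall>t\<in>\<phi> ` F. x t = i t}"
      using process_law_cylinder(2)[OF F'] by simp
    also have "\<dots> = measure (process_law M E S \<alpha>) {x \<in> S \<rightarrow>\<^sub>E E. \<forall>s\<in>F. x s = i (\<phi> s)}"
      unfolding shift_action_cylinder[OF G(3) F(2), symmetric]
      using G(1,2) process_law_cylinder(1)[OF F, of "\<lambda>s. i (\<phi> s)"] unfolding invariant_law_def by blast
    also have "\<dots> = atom_prob F (\<lambda>s. i (\<phi> s))" using process_law_cylinder(2)[OF F] .
    finally show ?thesis .
  qed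
  define inv where "inv = the_inv_into S \<phi>"
  have inv: "inv (\<phi> s) = s" if "s \<in> F" for s
    using that F inj by (auto simp: inv_def the_inv_into_f_f subset_iff)
  show ?thesis
    unfolding expectation_info[OF F] expectation_info[OF F']
  proof (rule sum.reindex_bij_witness[where i = "\<lambda>k. \<lambda>t\<in>\<phi> ` F. k (inv t)" and j = "\<lambda>k. \<lambda>s\<in>F. k (\<phi> s)"])
    fix k assume k: "k \<in> \<phi> ` F \<rightarrow>\<^sub>E E"
    show "(\<lambda>t\<in>\<phi> ` F. (\<lambda>s\<in>F. k (\<phi> s)) (inv t)) = k"
      using k inv by (intro PiE_ext[of _ "\<phi> ` F" "\<lambda>_. E"]) auto
    show "(\<lambda>s\<in>F. k (\<phi> s)) \<in> F \<rightarrow>\<^sub>E E" using k by auto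
    have "atom_prob F (\<lambda>s\<in>F. k (\<phi> s)) = atom_prob (\<phi> ` F) k"
      unfolding p by (subst joint_atom_cong[of F _ "\<lambda>s. k (\<phi> s)"]) auto
    then show "atom_prob F (\<lambda>s\<in>F. k (\<phi> s)) * - ln (atom_prob F (\<lambda>s\<in>F. k (\<phi> s)))
        = atom_prob (\<phi> ` F) k * - ln (atom_prob (\<phi> ` F) k)" by simp
  next
    fix k assume k: "k \<in> F \<rightarrow>\<^sub>E E"
    show "(\<lambda>s\<in>F. (\<lambda>t\<in>\<phi> ` F. k (inv t)) (\<phi> s)) = k"
      using k inv by (intro PiE_ext[of _ F "\<lambda>_. E"]) auto
    show "(\<lambda>t\<in>\<phi> ` F. k (inv t)) \<in> \<phi> ` F \<rightarrow>\<^sub>E E" using k inv by auto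
  qed
qed

end

section \<open>Convergence of the normalised information\<close>

context prob_space
begin

text \<open>Sum and integral of the squares may be exchanged, so the series of squares has finite
  expectation. It converges almost surely, and its terms tend to 0.\<close>

lemma AE_tendsto_0_of_summable_second_moments:
  fixes X :: "nat \<Rightarrow> 'a \<Rightarrow> real"
  assumes int: "\<And>n. integrable M (\<lambda>\<omega>. (X n \<omega>)\<^sup>2)"
    and sm: "summable (\<lambda>n. expectation (\<lambda>\<omega>. (X n \<omega>)\<^sup>2))"
  shows "AE \<omega> in M. (\<lambda>n. X n \<omega>) \<longlonglongrightarrow> 0"
proof -
  have [measurable]: "(\<lambda>\<omega>. (X n \<omega>)\<^sup>2) \<in> borel_measurable M" for n
    using int by (rule borel_measurable_integrable)
  have "(\<integral>\<^sup>+\<omega>. (\<Sum>n. ennreal ((X n \<omega>)\<^sup>2)) \<partial>M) = (\<Sum>n. \<integral>\<^sup>+\<omega>. ennreal ((X n \<omega>)\<^sup>2) \<partial>M)"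
    by (rule nn_integral_suminf) measurable
  also have "\<dots> = (\<Sum>n. ennreal (expectation (\<lambda>\<omega>. (X n \<omega>)\<^sup>2)))"
    using int by (intro suminf_cong nn_integral_eq_integral) auto
  also have "\<dots> = ennreal (\<Sum>n. expectation (\<lambda>\<omega>. (X n \<omega>)\<^sup>2))"
    using sm by (intro suminf_ennreal2) auto
  finally have "(\<integral>\<^sup>+\<omega>. (\<Sum>n. ennreal ((X n \<omega>)\<^sup>2)) \<partial>M) \<noteq> \<infinity>" by simp
  then have "AE \<omega> in M. (\<Sum>n. ennreal ((X n \<omega>)\<^sup>2)) \<noteq> \<infinity>"
    by (intro nn_integral_PInf_AE) measurable
  then show ?thesis
  proof eventually_elim
    case (elim \<omega>)
    then have "summable (\<lambda>n. (X n \<omega>)\<^sup>2)" by (intro summable_suminf_not_top) auto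
    from tendsto_real_sqrt[OF summable_LIMSEQ_zero[OF this]] show ?case
      by (simp add: tendsto_rabs_zero_iff)
  qed
qed

text \<open>The variance of |X| is nonnegative.\<close>

lemma expectation_abs_le_sqrt:
  fixes X :: "'a \<Rightarrow> real"
  assumes "integrable M X" "integrable M (\<lambda>\<omega>. (X \<omega>)\<^sup>2)"
  shows "expectation (\<lambda>\<omega>. \<bar>X \<omega>\<bar>) \<le> sqrt (expectation (\<lambda>\<omega>. (X \<omega>)\<^sup>2))"
proof -
  have "0 \<le> variance (\<lambda>\<omega>. \<bar>X \<omega>\<bar>)" by simp
  also have "\<dots> = expectation (\<lambda>\<omega>. (X \<omega>)\<^sup>2) - (expectation (\<lambda>\<omega>. \<bar>X \<omega>\<bar>))\<^sup>2"
    using assms by (subst variance_eq) auto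
  finally show ?thesis by (intro real_le_rsqrt) simp
qed

end

text \<open>Fixing one mixing constant \<open>C\<close> makes the error bounds below functions of
  the depth alone, the same for all edges.\<close>

locale tree_process = regular_tree_graph d S B + finite_process M E S \<alpha>
  for d :: nat and S :: "'s set" and B :: "'s set set"
    and M :: "'w measure" and E :: "'e set" and \<alpha> :: "'s \<Rightarrow> 'w \<Rightarrow> 'e" +
  fixes lam C :: real
  assumes invariant: "invariant_law S (Aut0 S B) (process_law M E S \<alpha>)"
    and rate: "lam > 2 * ln (real d - 1)"
    and C_pos: "C > 0"
    and mixing: "\<And>U V. finite U \<Longrightarrow> U \<noteq> {} \<Longrightarrow> U \<subseteq> S \<Longrightarrow> finite V \<Longrightarrow> V \<noteq> {} \<Longrightarrow> V \<subseteq> S \<Longrightarrow>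
      C * real (card U) * real (card V) * exp (- (lam * real (graph_setdist S B U V))) \<le> 1 \<Longrightarrow>
      psi_coeff M E \<alpha> U V \<le>
        C * real (card U) * real (card V) * exp (- (lam * real (graph_setdist S B U V)))"
begin

definition eps :: "nat \<Rightarrow> real" where "eps m = C * real d * (1 / 4) ^ m"

definition L :: real where "L = ln (real (card E))"

definition J :: "'s \<Rightarrow> 's \<Rightarrow> nat \<Rightarrow> 'w \<Rightarrow> real" where
  "J p x m \<omega> = info (desc p x m) \<omega> / real q ^ m"

abbreviation J_mean :: "'s \<Rightarrow> 's \<Rightarrow> nat \<Rightarrow> real" where
  "J_mean p x m \<equiv> expectation (J p x m)"

lemma eps_nonneg: "eps m \<ge> 0"
  using C_pos by (simp add: eps_def)

lemma eps_tendsto: "eps \<longlonglongrightarrow> 0"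
proof -
  have "(\<lambda>m. C * real d * (1 / 4) ^ m) \<longlonglongrightarrow> C * real d * 0"
    by (intro tendsto_intros LIMSEQ_realpow_zero) auto
  then show ?thesis by (simp add: eps_def[abs_def])
qed

lemma exp_rate_le: "exp (- lam) \<le> 1 / (real q)\<^sup>2"
proof -
  have q: "real q > 0" "real d - 1 = real q" using q_ge_2 d_gt_2 by (auto simp: q_def)
  have "exp (- lam) \<le> exp (- (2 * ln (real q)))" using rate q by simp
  also have "\<dots> = 1 / (real q)\<^sup>2" using q by (simp add: exp_minus exp_double inverse_eq_divide)
  finally show ?thesis .
qed

lemma siblings_subset: "Y \<subseteq> nbrs x \<Longrightarrow> (\<Union>z\<in>Y. desc x z m) \<subseteq> S"
  using desc_subset by (fastforce simp: nbrs_iff)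

lemma finite_siblings: "x \<in> S \<Longrightarrow> Y \<subseteq> nbrs x \<Longrightarrow> finite (\<Union>z\<in>Y. desc x z m)"
  using finite_subset[OF _ finite_nbrs[of x], of Y] finite_desc[of x]
  by (intro finite_UN_I) (auto simp: nbrs_iff)

text \<open>Every geodesic between the two sets passes through \<open>x\<close>, so all distances
  are equal and the minimum is over a singleton.\<close>

lemma graph_setdist_siblings:
  assumes x: "x \<in> S" and Y: "Y \<subseteq> nbrs x" "Y \<noteq> {}" and y: "y \<in> nbrs x" "y \<notin> Y"
  shows "graph_setdist S B (desc x y m) (\<Union>z\<in>Y. desc x z m) = 2 * m + 2"
proof -
  have ne: "desc x z m \<noteq> {}" if "z \<in> nbrs x" for z
    using card_desc[of x z m] that q_ge_2 by (auto simp: nbrs_iff)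
  have dist: "graph_dist S B s t = 2 * m + 2" if "s \<in> desc x y m" "z \<in> Y" "t \<in> desc x z m" for s t z
  proof -
    have "{x, y} \<in> B" "{x, z} \<in> B" "y \<noteq> z" using that Y y by (auto simp: nbrs_iff subset_iff)
    from desc_dist[OF this that(1,3)] show ?thesis by simp
  qed
  obtain s z t where st: "s \<in> desc x y m" "z \<in> Y" "t \<in> desc x z m" using ne y Y by blast
  let ?D = "{graph_dist S B s t | s t. s \<in> desc x y m \<and> t \<in> (\<Union>z\<in>Y. desc x z m)}"
  have sub: "?D \<subseteq> {2 * m + 2}" using dist by blast
  have "graph_dist S B s t \<in> ?D" using st by blast
  then have "?D = {2 * m + 2}"
    using subset_singletonD[OF sub] by (elim disjE) (simp_all only: empty_iff)
  then show ?thesis by (simp add: graph_setdist_def)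
qed

text \<open>The sets have q^m and at most d q^m vertices, and e^(-lam) \<le> q^(-2) makes the
  distance factor at most q^(-4m), which leaves C d q^(-2m). The condition
  \<open>eps m \<le> 1\<close> ensures that the mixing hypothesis applies.\<close>

lemma psi_coeff_siblings:
  assumes x: "x \<in> S" and Y: "Y \<subseteq> nbrs x" "Y \<noteq> {}" and y: "y \<in> nbrs x" "y \<notin> Y"
    and le: "eps m \<le> 1"
  shows "psi_coeff M E \<alpha> (desc x y m) (\<Union>z\<in>Y. desc x z m) \<le> eps m"
proof -
  let ?U = "desc x y m" and ?V = "\<Union>z\<in>Y. desc x z m"
  have q: "real q \<ge> 2" using q_ge_2 by simp
  have fY: "finite Y" using finite_nbrs[OF x] Y finite_subset by blast
  have cU: "card ?U = q ^ m" using card_desc y by (simp add: nbrs_iff)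
  have cV: "card ?V = card Y * q ^ m"
    using Y by (intro card_UN_desc fY card_desc) (auto simp: nbrs_iff)
  have cY: "card Y \<le> d" using card_mono[OF finite_nbrs[OF x] Y(1)] card_nbrs[OF x] by simp
  have "ln (real d - 1) \<ge> 0" using d_gt_2 by (intro ln_ge_zero) simp
  then have lam: "lam > 0" using rate by linarith
  define b where "b = C * real (card ?U) * real (card ?V) * exp (- (lam * real (graph_setdist S B ?U ?V)))"
  \<comment> \<open>The summand 2 of the distance 2m + 2 is given away, so that the exponent is a
    multiple of m.\<close>
  have "exp (- (lam * real (graph_setdist S B ?U ?V))) \<le> exp (- lam * real (2 * m))"
    unfolding graph_setdist_siblings[OF x Y y] using lam by simp
  also have "\<dots> = exp (- lam) ^ (2 * m)" by (simp only: exp_of_nat2_mult)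
  also have "\<dots> \<le> (1 / (real q)\<^sup>2) ^ (2 * m)" by (intro power_mono exp_rate_le) simp
  finally have e: "exp (- (lam * real (graph_setdist S B ?U ?V))) \<le> (1 / (real q)\<^sup>2) ^ (2 * m)" .
  have "b \<le> C * real q ^ m * (real d * real q ^ m) * (1 / (real q)\<^sup>2) ^ (2 * m)"
    unfolding b_def cU cV using cY C_pos e by (intro mult_mono) (auto intro!: mult_mono)
  also have "\<dots> = C * real d * (real q ^ m * real q ^ m * (1 / (real q)\<^sup>2) ^ (2 * m))" by simp
  also have "real q ^ m * real q ^ m * (1 / (real q)\<^sup>2) ^ (2 * m) = (1 / (real q)\<^sup>2) ^ m"
    using q by (simp add: power_divide power_mult[symmetric] mult_2 mult_2_right power_add field_simps)
  also have "C * real d * (1 / (real q)\<^sup>2) ^ m \<le> C * real d * (1 / 4) ^ m"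
    using C_pos q power_mono[OF q, of 2]
    by (intro mult_left_mono power_mono divide_left_mono) (auto simp: zero_less_mult_iff)
  finally have "b \<le> eps m" by (simp add: eps_def)
  moreover have "psi_coeff M E \<alpha> ?U ?V \<le> b"
    unfolding b_def
  proof (rule mixing)
    show "finite ?U" "?U \<subseteq> S" using finite_desc desc_subset y by (auto simp: nbrs_iff)
    show "finite ?V" "?V \<subseteq> S" using finite_siblings siblings_subset x Y by auto
    show "?U \<noteq> {}" using cU q_ge_2 by auto
    have "card Y > 0" using fY Y by auto
    then show "?V \<noteq> {}" using cV q_ge_2 by (metis card.empty mult_is_0 not_gr_zero power_eq_0_iff not_numeral_le_zero)
    show "C * real (card ?U) * real (card ?V) * exp (- (lam * real (graph_setdist S B ?U ?V))) \<le> 1"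
      using \<open>b \<le> eps m\<close> le by (simp add: b_def)
  qed
  ultimately show ?thesis by simp
qed

text \<open>The sibling sets are added one at a time. Each new one is separated from the union of
  the previous ones by distance 2m + 2 and costs at most \<open>2 * eps m \<le> 1\<close>.\<close>

lemma AE_info_siblings:
  assumes x: "x \<in> S" and Y: "Y \<subseteq> nbrs x" and le: "eps m \<le> 1 / 2"
  shows "AE \<omega> in M. \<bar>info (\<Union>y\<in>Y. desc x y m) \<omega> - (\<Sum>y\<in>Y. info (desc x y m) \<omega>)\<bar> \<le> real (card Y)"
proof -
  have "finite Y" using finite_nbrs[OF x] Y finite_subset by blast
  then show ?thesis using Y
  proof (induction Y)
    case empty
    \<comment> \<open>The only atom of the empty union is the whole space, whose information is - ln
      1.\<close>
    then show ?case by (simp add: info_def joint_atom_def prob_space)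
  next
    case (insert y Y)
    show ?case
    proof (cases "Y = {}")
      case True
      then show ?thesis by simp
    next
      case False
      have "AE \<omega> in M. \<bar>info (desc x y m \<union> (\<Union>z\<in>Y. desc x z m)) \<omega> - info (desc x y m) \<omega>
          - info (\<Union>z\<in>Y. desc x z m) \<omega>\<bar> \<le> 2 * eps m"
      proof (rule AE_info_Un)
        show "finite (desc x y m)" "desc x y m \<subseteq> S"
          using finite_desc desc_subset insert.prems by (auto simp: nbrs_iff)
        show "finite (\<Union>z\<in>Y. desc x z m)" "(\<Union>z\<in>Y. desc x z m) \<subseteq> S"
          using finite_siblings[OF x] siblings_subset insert.prems by auto
        show "psi_coeff M E \<alpha> (desc x y m) (\<Union>z\<in>Y. desc x z m) \<le> eps m"
          using insert.hyps insert.prems False le by (intro psi_coeff_siblings[OF x]) auto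
      qed (rule le)
      moreover have "AE \<omega> in M. \<bar>info (\<Union>y\<in>Y. desc x y m) \<omega> - (\<Sum>y\<in>Y. info (desc x y m) \<omega>)\<bar> \<le> real (card Y)"
        using insert by auto
      ultimately show ?thesis
      proof eventually_elim
        case (elim \<omega>)
        then show ?case using insert.hyps le by (simp add: abs_le_iff)
      qed
    qed
  qed
qed

section \<open>Means and variances of the normalised information\<close>

lemma q_pos: "real q > 0" using q_ge_2 by simp

lemma L_nonneg: "L \<ge> 0"
proof -
  obtain r where r: "r \<in> S" using is_tree by (auto simp: is_tree_def)
  have "space M \<noteq> {}" by (rule not_empty)
  then have "E \<noteq> {}" using process_in_E[OF r] by blast
  then have "card E \<ge> 1" using finite_E by (simp add: Suc_le_eq card_gt_0_iff)
  then show ?thesis by (simp add: L_def)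
qed

context
  fixes p x :: 's
  assumes edge: "{p, x} \<in> B"
begin

lemma finite_edge_desc: "finite (desc p x m)" "desc p x m \<subseteq> S"
  using finite_desc desc_subset edge by auto

lemma integrable_J: "integrable M (J p x m)"
  unfolding J_def[abs_def] using integrable_info[OF finite_edge_desc] by simp

lemma integrable_J_square: "integrable M (\<lambda>\<omega>. (J p x m \<omega>)\<^sup>2)"
  using integrable_info_mult[OF finite_edge_desc finite_edge_desc, of m m]
  unfolding J_def[abs_def] by (simp add: power_divide power2_eq_square)

lemma J_mean_eq: "J_mean p x m = expectation (info (desc p x m)) / real q ^ m"
  unfolding J_def[abs_def] by simp

lemma J_mean_nonneg: "J_mean p x m \<ge> 0"
  unfolding J_mean_eq using expectation_info_nonneg by simp

lemma J_mean_le: "J_mean p x m \<le> L"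
  unfolding J_mean_eq using expectation_info_le[OF finite_edge_desc, of m] q_pos
  by (simp add: card_desc[OF edge] L_def pos_divide_le_eq mult.commute)

lemma variance_J_le: "variance (J p x m) \<le> 4 * real (card E) ^ (q ^ m)"
proof -
  have "variance (J p x m) \<le> expectation (\<lambda>\<omega>. (J p x m \<omega>)\<^sup>2)"
    by (subst variance_eq[OF integrable_J integrable_J_square]) simp
  also have "\<dots> = expectation (\<lambda>\<omega>. (info (desc p x m) \<omega>)\<^sup>2) / (real q ^ m)\<^sup>2"
    unfolding J_def by (simp add: power_divide)
  also have "\<dots> \<le> expectation (\<lambda>\<omega>. (info (desc p x m) \<omega>)\<^sup>2) / 1"
    using q_ge_2 by (intro divide_left_mono) (auto simp: one_le_power)
  also have "\<dots> \<le> 4 * real (card E) ^ (q ^ m)"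
    using expectation_info_square_le[OF finite_edge_desc, of m] by (simp add: card_desc[OF edge])
  finally show ?thesis .
qed

text \<open>The q children cost an error of at most q in total, which is divided by q^(m +
  1).\<close>

lemma AE_J_Suc:
  assumes "eps m \<le> 1 / 2"
  shows "AE \<omega> in M. \<bar>J p x (Suc m) \<omega> - (\<Sum>y\<in>nbrs x - {p}. J x y m \<omega>) / real q\<bar> \<le> 1 / real q ^ m"
proof -
  have x: "x \<in> S" using edge edgeD by blast
  have "AE \<omega> in M. \<bar>info (\<Union>y\<in>nbrs x - {p}. desc x y m) \<omega> - (\<Sum>y\<in>nbrs x - {p}. info (desc x y m) \<omega>)\<bar>
      \<le> real (card (nbrs x - {p}))"
    using assms by (intro AE_info_siblings[OF x]) auto
  then show ?thesis
  proof eventually_elim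
    case (elim \<omega>)
    let ?D = "info (desc p x (Suc m)) \<omega> - (\<Sum>y\<in>nbrs x - {p}. info (desc x y m) \<omega>)"
    have "J p x (Suc m) \<omega> - (\<Sum>y\<in>nbrs x - {p}. J x y m \<omega>) / real q = ?D / (real q * real q ^ m)"
      by (simp add: J_def sum_divide_distrib[symmetric] diff_divide_distrib mult.commute)
    then have "\<bar>J p x (Suc m) \<omega> - (\<Sum>y\<in>nbrs x - {p}. J x y m \<omega>) / real q\<bar> = \<bar>?D\<bar> / (real q * real q ^ m)"
      using q_pos by (simp only: abs_divide abs_of_pos zero_less_power mult_pos_pos)
    also have "\<bar>?D\<bar> \<le> real q" using elim card_nbrs_minus[OF edge] by simp
    then have "\<bar>?D\<bar> / (real q * real q ^ m) \<le> real q / (real q * real q ^ m)"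
      using q_pos by (intro divide_right_mono) simp_all
    also have "\<dots> = 1 / real q ^ m" using q_pos by simp
    finally show ?case .
  qed
qed

end

lemma J_error_mean:
  assumes e: "{p, x} \<in> B"
  shows "integrable M (\<lambda>\<omega>. J p x (Suc m) \<omega> - (\<Sum>y\<in>nbrs x - {p}. J x y m \<omega>) / real q)"
    and "expectation (\<lambda>\<omega>. J p x (Suc m) \<omega> - (\<Sum>y\<in>nbrs x - {p}. J x y m \<omega>) / real q)
      = J_mean p x (Suc m) - (\<Sum>y\<in>nbrs x - {p}. J_mean x y m) / real q"
proof -
  have iy: "integrable M (J x y m)" if "y \<in> nbrs x - {p}" for y
    using that by (intro integrable_J) (simp add: nbrs_iff)
  have iS: "integrable M (\<lambda>\<omega>. (\<Sum>y\<in>nbrs x - {p}. J x y m \<omega>) / real q)"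
    by (intro integrable_divide Bochner_Integration.integrable_sum iy)
  show "integrable M (\<lambda>\<omega>. J p x (Suc m) \<omega> - (\<Sum>y\<in>nbrs x - {p}. J x y m \<omega>) / real q)"
    using integrable_J[OF e] iS by (rule Bochner_Integration.integrable_diff)
  have "expectation (\<lambda>\<omega>. \<Sum>y\<in>nbrs x - {p}. J x y m \<omega>) = (\<Sum>y\<in>nbrs x - {p}. J_mean x y m)"
    by (rule Bochner_Integration.integral_sum) (rule iy)
  then show "expectation (\<lambda>\<omega>. J p x (Suc m) \<omega> - (\<Sum>y\<in>nbrs x - {p}. J x y m \<omega>) / real q)
      = J_mean p x (Suc m) - (\<Sum>y\<in>nbrs x - {p}. J_mean x y m) / real q"
    using Bochner_Integration.integral_diff[OF integrable_J[OF e] iS] by simp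
qed

lemma J_mean_Suc:
  assumes e: "{p, x} \<in> B" and le: "eps m \<le> 1 / 2"
  shows "\<bar>J_mean p x (Suc m) - (\<Sum>y\<in>nbrs x - {p}. J_mean x y m) / real q\<bar> \<le> 1 / real q ^ m"
proof -
  let ?R = "\<lambda>\<omega>. J p x (Suc m) \<omega> - (\<Sum>y\<in>nbrs x - {p}. J x y m \<omega>) / real q"
  have "\<bar>expectation ?R\<bar> \<le> expectation (\<lambda>\<omega>. \<bar>?R \<omega>\<bar>)"
    by (rule integral_abs_bound)
  also have "\<dots> \<le> expectation (\<lambda>_. 1 / real q ^ m)"
    using AE_J_Suc[OF e le] J_error_mean(1)[OF e] by (intro integral_mono_AE integrable_abs) auto
  finally show ?thesis unfolding J_error_mean(2)[OF e] by (simp add: prob_space)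
qed

text \<open>Dividing the relative bound of \<open>covariance_info_le\<close> by q^(2m) turns the
  entropies into means of \<open>J\<close>, each at most \<open>L\<close>.\<close>

lemma covariance_J_siblings:
  assumes x: "x \<in> S" and yz: "y \<in> nbrs x" "z \<in> nbrs x" "y \<noteq> z" and le: "eps m \<le> 1"
  shows "expectation (\<lambda>\<omega>. (J x y m \<omega> - J_mean x y m) * (J x z m \<omega> - J_mean x z m)) \<le> eps m * L\<^sup>2"
proof -
  have e: "{x, y} \<in> B" "{x, z} \<in> B" using yz by (simp_all add: nbrs_iff)
  note fin = finite_edge_desc[OF e(1), of m] finite_edge_desc[OF e(2), of m]
  have psi: "psi_coeff M E \<alpha> (desc x y m) (desc x z m) \<le> eps m"
    using psi_coeff_siblings[OF x, of "{z}" y m] yz le by simp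
  let ?Q = "real q ^ m"
  have int: "integrable M (\<lambda>\<omega>. J x y m \<omega> * J x z m \<omega>)"
    using integrable_info_mult[OF fin] unfolding J_def by simp
  have "expectation (\<lambda>\<omega>. (J x y m \<omega> - J_mean x y m) * (J x z m \<omega> - J_mean x z m)) =
      expectation (\<lambda>\<omega>. J x y m \<omega> * J x z m \<omega>) - J_mean x y m * J_mean x z m"
    using int integrable_J[OF e(1), of m] integrable_J[OF e(2), of m]
    by (simp add: algebra_simps prob_space)
  also have "\<dots> = (expectation (\<lambda>\<omega>. info (desc x y m) \<omega> * info (desc x z m) \<omega>) -
      expectation (info (desc x y m)) * expectation (info (desc x z m))) / (?Q * ?Q)"
    unfolding J_mean_eq[OF e(1)] J_mean_eq[OF e(2)] by (simp add: J_def diff_divide_distrib)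
  also have "\<dots> \<le> (eps m * (expectation (info (desc x y m)) * expectation (info (desc x z m)))) / (?Q * ?Q)"
    using covariance_info_le[OF fin psi] by (intro divide_right_mono) auto
  also have "\<dots> = eps m * (J_mean x y m * J_mean x z m)"
    unfolding J_mean_eq[OF e(1)] J_mean_eq[OF e(2)] by simp
  also have "\<dots> \<le> eps m * (L * L)"
    using J_mean_le e J_mean_nonneg eps_nonneg L_nonneg by (intro mult_left_mono mult_mono) auto
  finally show ?thesis by (simp add: power2_eq_square)
qed

text \<open>The first summand is 3/2 times the covariance error \<open>eps m * L\<^sup>2\<close>
  without its power of 1/4. The 12 is 3 times the 4 that comes from squaring the bound 2 / q^m of
  the centred error.\<close>

definition K :: real where "K = 3 / 2 * C * real d * L\<^sup>2 + 12"

text \<open>The children are nearly uncorrelated, so averaging over them halves the variance; the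
  factor \<open>3/4\<close> instead of \<open>1/2\<close> absorbs the bounded error of \<open>AE_J_Suc\<close>, by
  \<open>(a + b)\<^sup>2 \<le> 3/2 a\<^sup>2 + 3 b\<^sup>2\<close>.\<close>

lemma variance_J_Suc:
  assumes e: "{p, x} \<in> B" and le: "eps m \<le> 1 / 2"
    and A: "\<And>y. y \<in> nbrs x - {p} \<Longrightarrow> variance (J x y m) \<le> A"
  shows "variance (J p x (Suc m)) \<le> 3 / 4 * A + K * (1 / 4) ^ m"
proof -
  have x: "x \<in> S" using e edgeD by blast
  let ?N = "nbrs x - {p}"
  have N: "finite ?N" "card ?N = q" using finite_nbrs[OF x] card_nbrs_minus[OF e] by auto
  have eN: "{x, y} \<in> B" if "y \<in> ?N" for y using that by (simp add: nbrs_iff)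
  define D where "D y \<omega> = J x y m \<omega> - J_mean x y m" for y \<omega>
  define R0 where "R0 \<omega> = J p x (Suc m) \<omega> - (\<Sum>y\<in>?N. J x y m \<omega>) / real q" for \<omega>
  define X where "X \<omega> = (\<Sum>y\<in>?N. D y \<omega>) / real q" for \<omega>
  have iD: "integrable M (\<lambda>\<omega>. D y \<omega> * D z \<omega>)" if "y \<in> ?N" "z \<in> ?N" for y z
  proof -
    have "integrable M (\<lambda>\<omega>. J x y m \<omega> * J x z m \<omega>)"
      using integrable_info_mult[OF finite_edge_desc[OF eN[OF that(1)], of m] finite_edge_desc[OF eN[OF that(2)], of m]]
      unfolding J_def by simp
    then show ?thesis
      using integrable_J[OF eN[OF that(1)], of m] integrable_J[OF eN[OF that(2)], of m]
      unfolding D_def by (simp add: algebra_simps)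
  qed
  have X2: "(X \<omega>)\<^sup>2 = (\<Sum>y\<in>?N. \<Sum>z\<in>?N. D y \<omega> * D z \<omega>) / (real q)\<^sup>2" for \<omega>
    by (simp add: X_def power_divide power2_eq_square sum_product)
  have iX2: "integrable M (\<lambda>\<omega>. (X \<omega>)\<^sup>2)"
    unfolding X2 using iD by (intro integrable_divide Bochner_Integration.integrable_sum) auto
  have A0: "A \<ge> 0"
  proof -
    have "?N \<noteq> {}" using N(2) q_ge_2 by (metis card.empty not_numeral_le_zero)
    then obtain y where "y \<in> ?N" by blast
    from A[OF this] variance_positive[of "J x y m"] show ?thesis by linarith
  qed
  have EX2: "expectation (\<lambda>\<omega>. (X \<omega>)\<^sup>2) \<le> A / 2 + eps m * L\<^sup>2"
  proof -
    have "expectation (\<lambda>\<omega>. (X \<omega>)\<^sup>2) = (\<Sum>y\<in>?N. \<Sum>z\<in>?N. expectation (\<lambda>\<omega>. D y \<omega> * D z \<omega>)) / (real q)\<^sup>2"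
    proof -
      have "expectation (\<lambda>\<omega>. \<Sum>y\<in>?N. \<Sum>z\<in>?N. D y \<omega> * D z \<omega>)
          = (\<Sum>y\<in>?N. expectation (\<lambda>\<omega>. \<Sum>z\<in>?N. D y \<omega> * D z \<omega>))"
        by (intro Bochner_Integration.integral_sum Bochner_Integration.integrable_sum iD)
      also have "\<dots> = (\<Sum>y\<in>?N. \<Sum>z\<in>?N. expectation (\<lambda>\<omega>. D y \<omega> * D z \<omega>))"
        by (intro sum.cong refl Bochner_Integration.integral_sum iD)
      finally show ?thesis unfolding X2 by simp
    qed
    \<comment> \<open>The diagonal contributes at most A per child; the covariance error is allowed
      for every pair, including the diagonal ones.\<close>
    also have "(\<Sum>y\<in>?N. \<Sum>z\<in>?N. expectation (\<lambda>\<omega>. D y \<omega> * D z \<omega>))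
        \<le> (\<Sum>y\<in>?N. \<Sum>z\<in>?N. (if z = y then A else 0) + eps m * L\<^sup>2)"
    proof (intro sum_mono)
      fix y z assume yz: "y \<in> ?N" "z \<in> ?N"
      show "expectation (\<lambda>\<omega>. D y \<omega> * D z \<omega>) \<le> (if z = y then A else 0) + eps m * L\<^sup>2"
      proof (cases "z = y")
        case True
        then show ?thesis using A[OF yz(1)] eps_nonneg[of m]
          by (simp add: D_def power2_eq_square add_increasing2)
      next
        case False
        then show ?thesis using covariance_J_siblings[OF x, of y z m] yz le by (simp add: D_def)
      qed
    qed
    also have "\<dots> = real q * A + (real q)\<^sup>2 * (eps m * L\<^sup>2)"
      using N by (simp add: sum.distrib power2_eq_square algebra_simps)
    also have "(real q * A + (real q)\<^sup>2 * (eps m * L\<^sup>2)) / (real q)\<^sup>2 = A / real q + eps m * L\<^sup>2"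
      using q_pos by (simp add: add_divide_distrib power2_eq_square)
    also have "A / real q \<le> A / 2" using q_ge_2 A0 by (intro divide_left_mono) auto
    finally show ?thesis by (simp add: divide_right_mono)
  qed
  have R0: "AE \<omega> in M. \<bar>R0 \<omega>\<bar> \<le> 1 / real q ^ m" using AE_J_Suc[OF e le] by (simp add: R0_def)
  have mean: "expectation R0 = J_mean p x (Suc m) - (\<Sum>y\<in>?N. J_mean x y m) / real q"
    unfolding R0_def[abs_def] by (rule J_error_mean(2)[OF e])
  have ER0: "\<bar>expectation R0\<bar> \<le> 1 / real q ^ m"
    unfolding mean by (rule J_mean_Suc[OF e le])
  have dec: "J p x (Suc m) \<omega> - J_mean p x (Suc m) = X \<omega> + (R0 \<omega> - expectation R0)" for \<omega>
    unfolding mean by (simp add: X_def R0_def D_def sum_subtractf diff_divide_distrib)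
  have pt: "AE \<omega> in M. (J p x (Suc m) \<omega> - J_mean p x (Suc m))\<^sup>2 \<le> 3 / 2 * (X \<omega>)\<^sup>2 + 12 * (1 / 4) ^ m"
    using R0
  proof eventually_elim
    case (elim \<omega>)
    define r where "r = R0 \<omega> - expectation R0"
    \<comment> \<open>The error and its mean are each at most 1 / q^m in absolute value.\<close>
    have "\<bar>r\<bar> \<le> 2 / real q ^ m" using elim ER0 unfolding r_def by (simp add: abs_le_iff)
    then have "\<bar>r\<bar>\<^sup>2 \<le> (2 / real q ^ m)\<^sup>2" by (intro power_mono) auto
    then have "r\<^sup>2 \<le> 4 * (1 / (real q)\<^sup>2) ^ m"
      by (simp add: power_divide power_mult[symmetric] mult.commute)
    also have "\<dots> \<le> 4 * (1 / 4) ^ m"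
      using q_ge_2 power_mono[of 2 "real q" 2]
      by (intro mult_left_mono power_mono divide_left_mono) auto
    finally have r: "r\<^sup>2 \<le> 4 * (1 / 4) ^ m" .
    \<comment> \<open>Expanded, this says 2 X r \<le> X^2 / 2 + 2 r^2, the weighting that leaves the
      factor 3/2 on X^2.\<close>
    have "0 \<le> (X \<omega> - 2 * r)\<^sup>2 / 2" by simp
    then have "(X \<omega> + r)\<^sup>2 \<le> 3 / 2 * (X \<omega>)\<^sup>2 + 3 * r\<^sup>2" by (simp add: power2_eq_square algebra_simps)
    with r show ?case unfolding dec r_def[symmetric] by linarith
  qed
  have "integrable M (\<lambda>\<omega>. (J p x (Suc m) \<omega> - J_mean p x (Suc m))\<^sup>2)"
    using integrable_J[OF e, of "Suc m"] integrable_J_square[OF e, of "Suc m"]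
    by (simp add: power2_diff)
  then have "variance (J p x (Suc m)) \<le> expectation (\<lambda>\<omega>. 3 / 2 * (X \<omega>)\<^sup>2 + 12 * (1 / 4) ^ m)"
    using iX2 pt by (intro integral_mono_AE) auto
  also have "\<dots> = 3 / 2 * expectation (\<lambda>\<omega>. (X \<omega>)\<^sup>2) + 12 * (1 / 4) ^ m"
    using iX2 by (simp add: prob_space)
  also have "\<dots> \<le> 3 / 2 * (A / 2 + eps m * L\<^sup>2) + 12 * (1 / 4) ^ m" using EX2 by simp
  also have "\<dots> = 3 / 4 * A + K * (1 / 4) ^ m" by (simp add: K_def eps_def algebra_simps)
  finally show ?thesis .
qed

lemma eps_eventually: "\<exists>m0. \<forall>m\<ge>m0. eps m \<le> 1 / 2"
proof -
  have "\<forall>\<^sub>F m in sequentially. eps m < 1 / 2" using order_tendstoD(2)[OF eps_tendsto, of "1 / 2"] by simp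
  then show ?thesis unfolding eventually_sequentially by (meson less_imp_le)
qed

text \<open>The bound must hold for all edges at once, since one step uses the variances at the
  children. With G \<ge> 8 K the additive term is at most an eighth of the bound at depth m, and 3/4
  + 1/8 = 7/8. The other entry of the maximum in \<open>G\<close> covers the starting depth.\<close>

lemma variance_J_decay:
  "\<exists>G m0. \<forall>p x m. {p, x} \<in> B \<longrightarrow> m \<ge> m0 \<longrightarrow> variance (J p x m) \<le> G * (7 / 8) ^ m"
proof -
  obtain m0 where m0: "\<And>m. m \<ge> m0 \<Longrightarrow> eps m \<le> 1 / 2" using eps_eventually by blast
  define G where "G = max (8 * K) (4 * real (card E) ^ (q ^ m0) / (7 / 8) ^ m0)"
  have "variance (J p x m) \<le> G * (7 / 8) ^ m" if "{p, x} \<in> B" "m \<ge> m0" for p x m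
    using that(2,1)
  proof (induction m arbitrary: p x rule: dec_induct)
    case base
    have "4 * real (card E) ^ (q ^ m0) \<le> G * (7 / 8) ^ m0"
      by (simp add: G_def pos_divide_le_eq[symmetric])
    with variance_J_le[OF base, of m0] show ?case by (rule order_trans)
  next
    case (step m)
    have "variance (J p x (Suc m)) \<le> 3 / 4 * (G * (7 / 8) ^ m) + K * (1 / 4) ^ m"
      using step m0 by (intro variance_J_Suc) (auto simp: nbrs_iff)
    also have "K * (1 / 4) ^ m \<le> G / 8 * (7 / 8) ^ m"
    proof -
      have "K \<ge> 0" using C_pos by (simp add: K_def)
      then show ?thesis by (intro mult_mono power_mono) (auto simp: G_def)
    qed
    also have "3 / 4 * (G * (7 / 8) ^ m) + G / 8 * (7 / 8) ^ m = G * (7 / 8) ^ Suc m" by simp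
    finally show ?case by simp
  qed
  then show ?thesis by blast
qed

section \<open>Convergence to the means, and of the means\<close>

lemma summable_variance_J:
  assumes e: "{p, x} \<in> B" shows "summable (\<lambda>m. variance (J p x m))"
proof -
  obtain G m0 where *: "\<And>m. m \<ge> m0 \<Longrightarrow> variance (J p x m) \<le> G * (7 / 8) ^ m"
    using variance_J_decay e by blast
  show ?thesis
  proof (rule summable_comparison_test)
    show "\<exists>N. \<forall>m\<ge>N. norm (variance (J p x m)) \<le> G * (7 / 8) ^ m"
      using * by (intro exI[of _ m0]) simp
    show "summable (\<lambda>m. G * (7 / 8 :: real) ^ m)" by (intro summable_mult summable_geometric) simp
  qed
qed

lemma integrable_centered_J_square:
  "{p, x} \<in> B \<Longrightarrow> integrable M (\<lambda>\<omega>. (J p x m \<omega> - J_mean p x m)\<^sup>2)"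
  using integrable_J[of p x m] integrable_J_square[of p x m] by (simp add: power2_diff)

lemma AE_J_centered_tendsto:
  assumes e: "{p, x} \<in> B" shows "AE \<omega> in M. (\<lambda>m. J p x m \<omega> - J_mean p x m) \<longlonglongrightarrow> 0"
  using integrable_centered_J_square[OF e] summable_variance_J[OF e]
  by (rule AE_tendsto_0_of_summable_second_moments)

lemma L1_J_centered_tendsto:
  assumes e: "{p, x} \<in> B"
  shows "(\<lambda>m. expectation (\<lambda>\<omega>. \<bar>J p x m \<omega> - J_mean p x m\<bar>)) \<longlonglongrightarrow> 0"
proof (rule tendsto_sandwich[where f = "\<lambda>_. 0"])
  show "(\<lambda>m. sqrt (variance (J p x m))) \<longlonglongrightarrow> 0"
    using tendsto_real_sqrt[OF summable_LIMSEQ_zero[OF summable_variance_J[OF e]]] by simp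
  show "\<forall>\<^sub>F m in sequentially. expectation (\<lambda>\<omega>. \<bar>J p x m \<omega> - J_mean p x m\<bar>) \<le> sqrt (variance (J p x m))"
    using integrable_J[OF e] integrable_centered_J_square[OF e]
    by (intro always_eventually allI expectation_abs_le_sqrt) auto
qed (auto intro!: always_eventually)

text \<open>A color preserving automorphism carries one directed edge to the other and hence one
  descendant set onto the other.\<close>

lemma J_mean_color:
  assumes "{p, x} \<in> B" "{p', x'} \<in> B" "two_coloring S B c" "c x = c x'"
  shows "J_mean p x m = J_mean p' x' m"
proof -
  obtain \<phi> where \<phi>: "\<phi> \<in> Aut0 S B" "\<phi> p = p'" "\<phi> x = x'"
    using Aut0_transitive_on_edges[OF assms] by blast
  have "bij_betw \<phi> S S" using \<phi> by (simp add: Aut0_def graph_aut_def)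
  from expectation_info_image[OF invariant \<phi>(1) this finite_edge_desc[OF assms(1)], of m]
  show ?thesis
    unfolding J_mean_eq[OF assms(1)] J_mean_eq[OF assms(2)] Aut0_image_desc[OF \<phi>(1) assms(1)] \<phi>(2,3) by simp
qed

text \<open>The reversed edge replaces the children: they all have the color of \<open>p\<close>, so
  \<open>J_mean x y\<close> equals \<open>J_mean x p\<close> for each child \<open>y\<close>.
  Crossing the edge and coming back lowers the depth by two and returns to \<open>(p, x)\<close>
  itself, with errors 1 / q^(m + 1) and 1 / q^m.\<close>

lemma J_mean_Suc_Suc:
  assumes e: "{p, x} \<in> B" and le: "eps m \<le> 1 / 2" "eps (Suc m) \<le> 1 / 2"
  shows "\<bar>J_mean p x (Suc (Suc m)) - J_mean p x m\<bar> \<le> 2 / real q ^ m"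
proof -
  obtain c where c: "two_coloring S B c" using two_coloring_exists by blast
  have col: "c u \<noteq> c v" if "{u, v} \<in> B" for u v
    using c that edgeD[OF that] unfolding two_coloring_def by blast
  have avg: "\<bar>J_mean u v (Suc k) - J_mean v w k\<bar> \<le> 1 / real q ^ k"
    if h: "{u, v} \<in> B" "{v, w} \<in> B" "eps k \<le> 1 / 2" for u v w k
  proof -
    have "J_mean v y k = J_mean v w k" if "y \<in> nbrs v - {u}" for y
      using that h col[of v y] col[of v w] by (intro J_mean_color[OF _ _ c]) (auto simp: nbrs_iff)
    then have "(\<Sum>y\<in>nbrs v - {u}. J_mean v y k) / real q = J_mean v w k"
      using card_nbrs_minus[OF h(1)] q_pos by simp
    with J_mean_Suc[OF h(1,3)] show ?thesis by simp
  qed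
  have e': "{x, p} \<in> B" using e by (simp add: insert_commute)
  have "\<bar>J_mean p x (Suc (Suc m)) - J_mean x p (Suc m)\<bar> \<le> 1 / real q ^ Suc m"
    using avg[OF e e' le(2)] .
  moreover have "\<bar>J_mean x p (Suc m) - J_mean p x m\<bar> \<le> 1 / real q ^ m"
    using avg[OF e' e le(1)] .
  moreover have "1 / real q ^ Suc m \<le> 1 / real q ^ m"
    using q_ge_2 by (intro divide_left_mono) auto
  ultimately show ?thesis by linarith
qed

text \<open>Successive differences are dominated by a geometric series, and the partial sums of the
  differences telescope.\<close>

lemma J_mean_odd_convergent:
  assumes e: "{p, x} \<in> B" shows "convergent (\<lambda>n. J_mean p x (2 * n + 1))"
proof -
  obtain m0 where m0: "\<And>m. m \<ge> m0 \<Longrightarrow> eps m \<le> 1 / 2" using eps_eventually by blast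
  define u where "u n = J_mean p x (2 * n + 1)" for n
  have "\<bar>u (Suc n) - u n\<bar> \<le> 2 * (1 / 2) ^ n" if n: "n \<ge> m0" for n
  proof -
    have "\<bar>u (Suc n) - u n\<bar> \<le> 2 / real q ^ (2 * n + 1)"
      using J_mean_Suc_Suc[OF e, of "2 * n + 1"] m0 n by (simp add: u_def)
    also have "\<dots> \<le> 2 / 2 ^ n"
    proof (intro divide_left_mono)
      have "(2::real) ^ n \<le> 2 ^ (2 * n + 1)" by (intro power_increasing) auto
      also have "\<dots> \<le> real q ^ (2 * n + 1)" using q_ge_2 by (intro power_mono) auto
      finally show "(2::real) ^ n \<le> real q ^ (2 * n + 1)" .
    qed (use q_pos in auto)
    finally show ?thesis by (simp add: power_divide)
  qed
  note u_step = this
  have "summable (\<lambda>n. u (Suc n) - u n)"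
  proof (rule summable_comparison_test)
    show "\<exists>N. \<forall>n\<ge>N. norm (u (Suc n) - u n) \<le> 2 * (1 / 2) ^ n"
      using u_step by (intro exI[of _ m0]) simp
    show "summable (\<lambda>n. 2 * (1 / 2 :: real) ^ n)" by (intro summable_mult summable_geometric) simp
  qed
  then have "convergent (\<lambda>n. \<Sum>i<n. u (Suc i) - u i)" by (simp add: summable_iff_convergent)
  then have "convergent (\<lambda>n. u n - u 0)" by (simp add: sum_lessThan_telescope)
  then have "convergent (\<lambda>n. (u n - u 0) + u 0)" by (intro convergent_add convergent_const)
  then show ?thesis by (simp add: u_def)
qed

lemma information_spheres_converge:
  assumes s0: "s0 \<in> S"
  shows "\<exists>h\<in>{0..ln (real (card E))}.
    converges_L1 M
      (\<lambda>n \<omega>. process_information M E \<alpha> (graph_sphere S B s0 (2 * n)) \<omega> /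
              real (card (graph_sphere S B s0 (2 * n))))
      (\<lambda>_. h) \<and>
    (AE \<omega> in M.
      (\<lambda>n. process_information M E \<alpha> (graph_sphere S B s0 (2 * n)) \<omega> /
              real (card (graph_sphere S B s0 (2 * n)))) \<longlonglongrightarrow> h)"
proof -
  define T where "T n \<omega> = process_information M E \<alpha> (graph_sphere S B s0 (2 * n)) \<omega> /
      real (card (graph_sphere S B s0 (2 * n)))" for n \<omega>
  let ?N = "nbrs s0"
  have N: "finite ?N" "card ?N = d" using finite_nbrs card_nbrs s0 by auto
  have edge: "{s0, y} \<in> B" if "y \<in> ?N" for y using that by (simp add: nbrs_iff)
  have d: "real d > 0" using d_gt_2 by simp
  have "?N \<noteq> {}" using N(2) d_gt_2 by (metis card.empty not_less_zero)
  then obtain y0 where y0: "y0 \<in> ?N" by blast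
  \<comment> \<open>The sphere of radius 2 (n + 1) lies at depth 2n + 1 below the neighbours of
    \<open>s0\<close>. Hence \<open>T (Suc n)\<close> is compared with the quantities of index n,
    and radius 0 is left out of the comparison.\<close>
  define k where "k n = 2 * n + 1" for n :: nat
  define u where "u n = J_mean s0 y0 (k n)" for n
  obtain h where h: "u \<longlonglongrightarrow> h"
    using J_mean_odd_convergent[OF edge[OF y0]] unfolding convergent_def u_def[abs_def] k_def by blast
  have u_eq: "J_mean s0 y (k n) = u n" if y: "y \<in> ?N" for y n
  proof -
    obtain c where c: "two_coloring S B c" using two_coloring_exists by blast
    then have "c y = c y0"
      using edge[OF y] edge[OF y0] edgeD[of s0] unfolding two_coloring_def by metis
    then show ?thesis unfolding u_def by (rule J_mean_color[OF edge[OF y] edge[OF y0] c])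
  qed
  have h_in: "h \<in> {0..L}"
  proof -
    have "0 \<le> h" using h by (rule LIMSEQ_le_const) (simp add: u_def J_mean_nonneg[OF edge[OF y0]])
    moreover have "h \<le> L" using h by (rule LIMSEQ_le_const2) (simp add: u_def J_mean_le[OF edge[OF y0]])
    ultimately show ?thesis by simp
  qed
  define W where "W n \<omega> = (\<Sum>y\<in>?N. J s0 y (k n) \<omega>) / real d" for n \<omega>
  define r where "r n = 1 / real q ^ k n" for n
  have k_top: "filterlim k sequentially sequentially"
    by (rule filterlim_subseq) (simp add: strict_mono_def k_def)
  have r: "r \<longlonglongrightarrow> 0"
  proof -
    have "(\<lambda>m. (1 / real q) ^ m) \<longlonglongrightarrow> 0" using q_ge_2 by (intro LIMSEQ_realpow_zero) auto
    from filterlim_compose[OF this k_top] show ?thesis by (simp add: r_def[abs_def] power_divide)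
  qed
  have fin_sphere: "finite (graph_sphere S B s0 m)" "graph_sphere S B s0 m \<subseteq> S" for m
  proof -
    show "graph_sphere S B s0 m \<subseteq> S" by (auto simp: graph_sphere_def)
    show "finite (graph_sphere S B s0 m)"
    proof (cases m)
      case 0
      then show ?thesis by (simp add: sphere_0[OF s0])
    next
      case (Suc j)
      then show ?thesis using finite_siblings[OF s0 order_refl] by (simp add: sphere_Suc[OF s0])
    qed
  qed
  have iT: "integrable M (T n)" for n
  proof -
    have "integrable M (\<lambda>\<omega>. process_information M E \<alpha> (graph_sphere S B s0 (2 * n)) \<omega>)"
      using integrable_info[OF fin_sphere] process_information_eq[OF fin_sphere]
      by (subst Bochner_Integration.integrable_cong[OF refl]) auto
    then show ?thesis unfolding T_def[abs_def] by (rule integrable_divide)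
  qed
  have iJ: "integrable M (J s0 y m)" if "y \<in> ?N" for y m using integrable_J edge that by blast
  have iW: "integrable M (W n)" for n
    unfolding W_def[abs_def] by (intro integrable_divide Bochner_Integration.integrable_sum iJ)
  obtain m0 where m0: "\<And>m. m \<ge> m0 \<Longrightarrow> eps m \<le> 1 / 2" using eps_eventually by blast
  \<comment> \<open>The d branches cost an error of at most d in total, and the sphere has d q^(2n +
    1) vertices.\<close>
  have TW: "AE \<omega> in M. \<bar>T (Suc n) \<omega> - W n \<omega>\<bar> \<le> r n" if n: "n \<ge> m0" for n
  proof -
    have le: "eps (k n) \<le> 1 / 2" using m0 n by (simp add: k_def)
    have sph: "graph_sphere S B s0 (2 * Suc n) = (\<Union>y\<in>?N. desc s0 y (k n))"
      using sphere_Suc[OF s0, of "k n"] by (simp add: k_def)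
    have csph: "card (graph_sphere S B s0 (2 * Suc n)) = d * q ^ k n"
      using card_sphere[OF s0, of "k n"] by (simp add: k_def)
    show ?thesis
      using AE_info_siblings[OF s0 order_refl le] AE_space
    proof eventually_elim
      case (elim \<omega>)
      let ?D = "info (\<Union>y\<in>?N. desc s0 y (k n)) \<omega> - (\<Sum>y\<in>?N. info (desc s0 y (k n)) \<omega>)"
      have "T (Suc n) \<omega> = info (\<Union>y\<in>?N. desc s0 y (k n)) \<omega> / (real d * real q ^ k n)"
        unfolding T_def process_information_eq[OF fin_sphere elim(2)] csph unfolding sph by simp
      moreover have "W n \<omega> = (\<Sum>y\<in>?N. info (desc s0 y (k n)) \<omega>) / (real d * real q ^ k n)"
        by (simp add: W_def J_def sum_divide_distrib[symmetric] mult.commute)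
      ultimately have "T (Suc n) \<omega> - W n \<omega> = ?D / (real d * real q ^ k n)"
        by (simp add: diff_divide_distrib)
      then have "\<bar>T (Suc n) \<omega> - W n \<omega>\<bar> = \<bar>?D\<bar> / (real d * real q ^ k n)"
        using d q_pos by (simp only: abs_divide abs_of_pos zero_less_power mult_pos_pos)
      also have "\<dots> \<le> real d / (real d * real q ^ k n)"
        using elim(1) N d q_pos by (intro divide_right_mono) simp_all
      also have "\<dots> = r n" using d by (simp add: r_def)
      finally show ?case .
    qed
  qed
  \<comment> \<open>One pointwise bound serves both modes of convergence: its right-hand side tends
    to 0 almost surely and in expectation. The factor 1 / d is given away.\<close>
  have W_h: "\<bar>W n \<omega> - h\<bar> \<le> (\<Sum>y\<in>?N. \<bar>J s0 y (k n) \<omega> - J_mean s0 y (k n)\<bar>) + \<bar>u n - h\<bar>" for n \<omega>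
  proof -
    have "W n \<omega> - u n = (\<Sum>y\<in>?N. J s0 y (k n) \<omega> - J_mean s0 y (k n)) / real d"
      using N d by (simp add: W_def sum_subtractf u_eq diff_divide_distrib)
    then have "\<bar>W n \<omega> - u n\<bar> = \<bar>\<Sum>y\<in>?N. J s0 y (k n) \<omega> - J_mean s0 y (k n)\<bar> / real d"
      using d by (simp only: abs_divide abs_of_pos)
    also have "\<dots> \<le> \<bar>\<Sum>y\<in>?N. J s0 y (k n) \<omega> - J_mean s0 y (k n)\<bar> / 1"
      using d_gt_2 by (intro divide_left_mono) auto
    also have "\<dots> \<le> (\<Sum>y\<in>?N. \<bar>J s0 y (k n) \<omega> - J_mean s0 y (k n)\<bar>)"
      using sum_abs[of "\<lambda>y. J s0 y (k n) \<omega> - J_mean s0 y (k n)" ?N] by simp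
    finally show ?thesis by linarith
  qed
  have uh: "(\<lambda>n. \<bar>u n - h\<bar>) \<longlonglongrightarrow> 0" using h by (simp add: LIM_zero tendsto_rabs_zero)
  have AE_lim: "AE \<omega> in M. (\<lambda>n. T n \<omega>) \<longlonglongrightarrow> h"
  proof -
    \<comment> \<open>The exceptional null sets are collected over countably many n here and over
      finitely many neighbours in the next fact.\<close>
    have 1: "AE \<omega> in M. \<forall>n. n \<ge> m0 \<longrightarrow> \<bar>T (Suc n) \<omega> - W n \<omega>\<bar> \<le> r n"
      unfolding AE_all_countable using TW by auto
    have 2: "AE \<omega> in M. \<forall>y\<in>?N. (\<lambda>m. J s0 y m \<omega> - J_mean s0 y m) \<longlonglongrightarrow> 0"
      using N(1) AE_J_centered_tendsto[OF edge] by (intro AE_finite_allI) auto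
    from 1 2 show ?thesis
    proof eventually_elim
      case (elim \<omega>)
      have "(\<lambda>n. \<bar>J s0 y (k n) \<omega> - J_mean s0 y (k n)\<bar>) \<longlonglongrightarrow> 0" if "y \<in> ?N" for y
        using filterlim_compose[OF _ k_top, OF elim(2)[rule_format, OF that]] by (rule tendsto_rabs_zero)
      then have "(\<lambda>n. r n + ((\<Sum>y\<in>?N. \<bar>J s0 y (k n) \<omega> - J_mean s0 y (k n)\<bar>) + \<bar>u n - h\<bar>)) \<longlonglongrightarrow> 0 + ((\<Sum>y\<in>?N. 0) + 0)"
        by (intro tendsto_add r uh tendsto_sum)
      then have lim: "(\<lambda>n. r n + ((\<Sum>y\<in>?N. \<bar>J s0 y (k n) \<omega> - J_mean s0 y (k n)\<bar>) + \<bar>u n - h\<bar>)) \<longlonglongrightarrow> 0"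
        by simp
      have "\<bar>T (Suc n) \<omega> - h\<bar> \<le> r n + ((\<Sum>y\<in>?N. \<bar>J s0 y (k n) \<omega> - J_mean s0 y (k n)\<bar>) + \<bar>u n - h\<bar>)"
        if "n \<ge> m0" for n
        using elim(1)[rule_format, OF that] W_h[of n \<omega>] by linarith
      then have "\<forall>\<^sub>F n in sequentially. norm (T (Suc n) \<omega> - h)
          \<le> r n + ((\<Sum>y\<in>?N. \<bar>J s0 y (k n) \<omega> - J_mean s0 y (k n)\<bar>) + \<bar>u n - h\<bar>)"
        unfolding eventually_sequentially real_norm_def by blast
      then have "(\<lambda>n. T (Suc n) \<omega> - h) \<longlonglongrightarrow> 0" by (rule Lim_null_comparison) (rule lim)
      from LIM_zero_cancel[OF this] show ?case by (rule LIMSEQ_imp_Suc[of "\<lambda>n. T n \<omega>"])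
    qed
  qed
  have "(\<lambda>n. expectation (\<lambda>\<omega>. \<bar>T (Suc n) \<omega> - h\<bar>)) \<longlonglongrightarrow> 0"
  proof (rule Lim_null_comparison)
    let ?g = "\<lambda>n. r n + ((\<Sum>y\<in>?N. expectation (\<lambda>\<omega>. \<bar>J s0 y (k n) \<omega> - J_mean s0 y (k n)\<bar>)) + \<bar>u n - h\<bar>)"
    have iA: "integrable M (\<lambda>\<omega>. \<bar>J s0 y (k n) \<omega> - J_mean s0 y (k n)\<bar>)" if "y \<in> ?N" for y n
      using iJ[OF that] by simp
    have "expectation (\<lambda>\<omega>. \<bar>T (Suc n) \<omega> - h\<bar>) \<le> ?g n" if n: "n \<ge> m0" for n
    proof -
      have iS: "integrable M (\<lambda>\<omega>. \<Sum>y\<in>?N. \<bar>J s0 y (k n) \<omega> - J_mean s0 y (k n)\<bar>)"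
        by (intro Bochner_Integration.integrable_sum iA)
      have "AE \<omega> in M. \<bar>T (Suc n) \<omega> - h\<bar>
          \<le> r n + ((\<Sum>y\<in>?N. \<bar>J s0 y (k n) \<omega> - J_mean s0 y (k n)\<bar>) + \<bar>u n - h\<bar>)"
        using TW[OF n]
      proof eventually_elim
        case (elim \<omega>)
        then show ?case using W_h[of n \<omega>] by linarith
      qed
      then have "expectation (\<lambda>\<omega>. \<bar>T (Suc n) \<omega> - h\<bar>) \<le>
          expectation (\<lambda>\<omega>. r n + ((\<Sum>y\<in>?N. \<bar>J s0 y (k n) \<omega> - J_mean s0 y (k n)\<bar>) + \<bar>u n - h\<bar>))"
        using iT[of "Suc n"] iS by (intro integral_mono_AE) auto
      also have "\<dots> = r n + (expectation (\<lambda>\<omega>. \<Sum>y\<in>?N. \<bar>J s0 y (k n) \<omega> - J_mean s0 y (k n)\<bar>) + \<bar>u n - h\<bar>)"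
        using iS by (simp add: prob_space)
      also have "expectation (\<lambda>\<omega>. \<Sum>y\<in>?N. \<bar>J s0 y (k n) \<omega> - J_mean s0 y (k n)\<bar>)
          = (\<Sum>y\<in>?N. expectation (\<lambda>\<omega>. \<bar>J s0 y (k n) \<omega> - J_mean s0 y (k n)\<bar>))"
        by (intro Bochner_Integration.integral_sum iA)
      finally show ?thesis .
    qed
    then show "\<forall>\<^sub>F n in sequentially. norm (expectation (\<lambda>\<omega>. \<bar>T (Suc n) \<omega> - h\<bar>)) \<le> ?g n"
      unfolding eventually_sequentially by (intro exI[of _ m0]) simp
    have "(\<lambda>n. expectation (\<lambda>\<omega>. \<bar>J s0 y (k n) \<omega> - J_mean s0 y (k n)\<bar>)) \<longlonglongrightarrow> 0" if "y \<in> ?N" for y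
      using filterlim_compose[OF L1_J_centered_tendsto[OF edge[OF that]] k_top] .
    then have "?g \<longlonglongrightarrow> 0 + ((\<Sum>y\<in>?N. 0) + 0)"
      by (intro tendsto_add r uh tendsto_sum)
    then show "?g \<longlonglongrightarrow> 0" by simp
  qed
  then have "(\<lambda>n. expectation (\<lambda>\<omega>. \<bar>T n \<omega> - h\<bar>)) \<longlonglongrightarrow> 0"
    by (rule LIMSEQ_imp_Suc[of "\<lambda>n. expectation (\<lambda>\<omega>. \<bar>T n \<omega> - h\<bar>)"])
  with iT have "converges_L1 M T (\<lambda>_. h)" unfolding converges_L1_def by simp
  with AE_lim h_in show ?thesis unfolding T_def[abs_def] L_def by blast
qed

end

theorem theorem1p2:
  fixes d :: nat
    and S :: "'s set" and B :: "'s set set" and s0 :: 's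
    and E :: "'e set"
    and M :: "'w measure" and \<alpha> :: "'s \<Rightarrow> 'w \<Rightarrow> 'e"
    and lam :: real
  assumes "d > 2"
    and "regular_tree d S B"
    and "s0 \<in> S"
    and "finite E"
    and "standard_prob_space M"
    and "process M E S \<alpha>"
    and "invariant_law S (Aut0 S B) (process_law M E S \<alpha>)"
    and "psi_mixing M E S B \<alpha> lam"
    and "lam > 2 * ln (real d - 1)"
  shows "\<exists>h\<in>{0..ln (real (card E))}.
    converges_L1 M
      (\<lambda>n \<omega>. process_information M E \<alpha> (graph_sphere S B s0 (2 * n)) \<omega> /
              real (card (graph_sphere S B s0 (2 * n))))
      (\<lambda>_. h) \<and>
    (AE \<omega> in M.
      (\<lambda>n. process_information M E \<alpha> (graph_sphere S B s0 (2 * n)) \<omega> /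
              real (card (graph_sphere S B s0 (2 * n)))) \<longlonglongrightarrow> h)"
proof -
  obtain C where C: "C > 0"
    and mix: "\<forall>U V. finite U \<and> U \<noteq> {} \<and> U \<subseteq> S \<and> finite V \<and> V \<noteq> {} \<and> V \<subseteq> S \<longrightarrow>
        (let b = C * real (card U) * real (card V) * exp (- (lam * real (graph_setdist S B U V)))
         in b \<le> 1 \<longrightarrow> psi_coeff M E \<alpha> U V \<le> b)"
    using assms(8) unfolding psi_mixing_def by (elim conjE exE) simp
  interpret prob_space M using assms(5) by (simp add: standard_prob_space_def)
  interpret tree_process d S B M E \<alpha> lam C
  proof unfold_locales
    show "psi_coeff M E \<alpha> U V \<le>
        C * real (card U) * real (card V) * exp (- (lam * real (graph_setdist S B U V)))"
      if "finite U" "U \<noteq> {}" "U \<subseteq> S" "finite V" "V \<noteq> {}" "V \<subseteq> S"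
        "C * real (card U) * real (card V) * exp (- (lam * real (graph_setdist S B U V))) \<le> 1" for U V
      using mix[rule_format, of U V] that by (simp add: Let_def)
  qed (use assms C in simp_all)
  show ?thesis by (rule information_spheres_converge[OF assms(3)])
qed

end
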